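(* For any fixed $e\in[0,1)$, the set $I_e=\{\beta\in(0,9]:\ \sigma(\gamma_{\beta,e}(2\pi))\subset\mathbb C\setminus(\mathbf U\cup\mathbb R)\}$ (the set of $\beta$ for which the spectrum of $\gamma_{\beta,e}(2\pi)$ is of complex-saddle type) is a non-empty open set.
   Context: $\mathbf U$ is the unit circle in $\mathbb C$, $\sigma(M)$ the spectrum of $M$. Let $J=\begin{pmatrix}0&-I_2\\ I_2&0\end{pmatrix}$ and $\mathrm{Sp}(4)=\{M\in \mathrm{GL}(4,\mathbb R): M^TJM=J\}$. For $(\beta,e)\in[0,9]\times[0,1)$ let $\gamma_{\beta,e}:[0,2\pi]\to\mathrm{Sp}(4)$ be the solution of $\dot\gamma(t)=JB(t)\gamma(t)$, $\gamma(0)=I_4$, where $$B(t)=\begin{pmatrix}1&0&0&1\\0&1&-1&0\\0&-1&\frac{2e\cos t-1-\sqrt{9-\beta}}{2(1+e\cos t)}&0\\1&0&0&\frac{2e\cos t-1+\sqrt{9-\beta}}{2(1+e\cos t)}\end{pmatrix}.$$ (It is the essential part of the fundamental solution of the linearized system along the elliptic Lagrangian solution of the planar three-body problem with eccentricity $e$ and mass parameter $\beta$.) *)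

theory Defs
  imports "HOL-Analysis.Analysis"
begin

definition J4 :: "real^4^4" where
  "J4 = vector
    [vector [0, 0, -1,  0],
     vector [0, 0,  0, -1],
     vector [1, 0,  0,  0],
     vector [0, 1,  0,  0]]"

definition Bmat :: "real \<Rightarrow> real \<Rightarrow> real \<Rightarrow> real^4^4" where
  "Bmat \<beta> e t = vector
    [vector [1,  0, 0, 1],
     vector [0,  1, -1, 0],
     vector [0, -1, (2 * e * cos t - 1 - sqrt (9 - \<beta>)) / (2 * (1 + e * cos t)), 0],
     vector [1,  0, 0, (2 * e * cos t - 1 + sqrt (9 - \<beta>)) / (2 * (1 + e * cos t))]]"

definition is_fundamental_solution :: "real \<Rightarrow> real \<Rightarrow> (real \<Rightarrow> real^4^4) \<Rightarrow> bool" where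
  "is_fundamental_solution \<beta> e g \<longleftrightarrow>
     g 0 = mat 1 \<and>
     (\<forall>t\<in>{0..2 * pi}.
        (g has_vector_derivative (J4 ** Bmat \<beta> e t ** g t)) (at t within {0..2 * pi}))"

(* For 0 <= \<beta> <= 9 and 0 <= e < 1 the coefficients are continuous, so a solution exists and
   its restriction to [0, 2 pi] is unique (and symplectic, since Bmat is symmetric);
   the choice below only affects arguments outside [0, 2 pi]. *)
definition fundamental_solution :: "real \<Rightarrow> real \<Rightarrow> real \<Rightarrow> real^4^4" where
  "fundamental_solution \<beta> e = (SOME g. is_fundamental_solution \<beta> e g)"

definition cspectrum :: "real^'n^'n \<Rightarrow> complex set" where
  "cspectrum M = {z. \<not> invertible (map_matrix complex_of_real M - mat z)}"

definition complex_saddle_set :: "real \<Rightarrow> real set" where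
  "complex_saddle_set e =
     {\<beta> \<in> {0<..9}. cspectrum (fundamental_solution \<beta> e (2 * pi)) \<subseteq> - (sphere 0 1 \<union> \<real>)}"

end

theory Submission
  imports Defs
begin

text \<open>
  Write \<open>M\<close> for the monodromy matrix. Since \<open>M\<close> is symplectic, \<open>M + M\<^sup>-\<^sup>1\<close> satisfies a real quadratic equation
  \<open>u\<^sup>2 - c u + d = 0\<close>, \<open>c\<close> being the trace of \<open>M\<close>, and the eigenvalues \<open>z\<close> of \<open>M\<close> are governed by \<open>u = z + 1/z\<close>;
  hence \<open>M\<close> is a complex saddle iff the discriminant \<open>c\<^sup>2 - 4 d\<close> is negative, an open condition on \<open>\<beta>\<close>.
  At \<open>\<beta> = 9\<close> the system decouples, in non-rotating coordinates, into two copies of the Hill equation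
  \<open>y'' = (3 / (2 (1 + e cos t)) - 1) y\<close>. So the discriminant vanishes there and \<open>9\<close> does not belong to the set; moreover
  \<open>1 + e cos t\<close> is a strict supersolution of this equation, which gives \<open>c > 4\<close>.

  For \<open>0 < \<beta> \<le> 9\<close> the number 1 is not an eigenvalue, because the action functional is positive definite on
  periodic loops: it is a convex combination of the functionals for \<open>\<beta> = 9\<close> (positive) and \<open>\<beta> = 0\<close> (Kepler, nonnegative
  by a Picone identity built from explicit variations of the Kepler ellipse). Hence \<open>4 - 2 c + d > 0\<close> on \<open>(0, 9)\<close>.
  A two-point boundary determinant at \<open>t = \<pi>\<close> changes sign between \<open>\<beta> = 0\<close> and \<open>\<beta> = 9\<close>; at a zero of it \<open>-1\<close> is an
  eigenvalue, that is, \<open>4 + 2 c + d = 0\<close>, and so \<open>c < 0\<close>. Therefore \<open>c = 4\<close> for some \<open>\<beta>\<close> in between, where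
  \<open>d > 4\<close> and the discriminant \<open>16 - 4 d\<close> is negative.
\<close>

section \<open>Linear differential equations\<close>

text \<open>The Lipschitz bound is global in \<open>x\<close>, so the Picard iterates converge on
  all of \<open>{0..b}\<close> at once, without gluing short intervals: measured against the weight
  \<open>exp (2 * K * t)\<close>, every iteration halves the distance.\<close>

lemma picard_global:
  fixes F :: "real \<Rightarrow> 'a::banach \<Rightarrow> 'a" and x0 :: 'a
  assumes b: "0 \<le> b"
    and cont: "\<And>x. continuous_on {0..b} x \<Longrightarrow> continuous_on {0..b} (\<lambda>t. F t (x t))"
    and lip: "\<And>t x y. t \<in> {0..b} \<Longrightarrow> norm (F t x - F t y) \<le> K * norm (x - y)"
    and K: "0 < K"
  shows "\<exists>x. x 0 = x0 \<and> (\<forall>t\<in>{0..b}. (x has_vector_derivative F t (x t)) (at t within {0..b}))"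
proof -
  define X where "X = rec_nat (\<lambda>t. x0) (\<lambda>n x t. x0 + integral {0..t} (\<lambda>s. F s (x s)))"
  have X0: "X 0 t = x0" and XS: "X (Suc n) t = x0 + integral {0..t} (\<lambda>s. F s (X n s))" for n t
    by (auto simp: X_def)
  have XS': "X (Suc n) = (\<lambda>t. x0 + integral {0..t} (\<lambda>s. F s (X n s)))" for n
    by (rule ext) (rule XS)
  have cX: "continuous_on {0..b} (X n)" for n
  proof (induction n)
    case 0
    have "X 0 = (\<lambda>t. x0)" by (rule ext) (rule X0)
    then show ?case by simp
  next
    case (Suc n)
    then show ?case
      unfolding XS'
      by (intro continuous_intros indefinite_integral_continuous_1 integrable_continuous_real cont)
  qed
  have iX: "(\<lambda>s. F s (x s)) integrable_on {0..t}" if "t \<in> {0..b}" "continuous_on {0..b} x" for x t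
    by (rule integrable_continuous_real, rule continuous_on_subset[OF cont]) (use that in auto)
  have "bounded ((\<lambda>t. X 1 t - X 0 t) ` {0..b})"
    by (intro compact_imp_bounded compact_continuous_image continuous_intros cX) auto
  then obtain C where C: "\<And>t. t \<in> {0..b} \<Longrightarrow> norm (X 1 t - X 0 t) \<le> C"
    unfolding bounded_iff by blast
  have C0: "0 \<le> C" by (rule order_trans[OF norm_ge_zero C[of 0]]) (use b in auto)
  have diff: "norm (X (Suc n) t - X n t) \<le> C * (1/2)^n * exp (2 * K * t)" if "t \<in> {0..b}" for n t
    using that
  proof (induction n arbitrary: t)
    case 0
    have "C * 1 \<le> C * exp (2*K*t)" using C0 K 0 by (intro mult_left_mono) auto
    then show ?case using C[OF 0] by simp
  next
    case (Suc n)
    have eq: "X (Suc (Suc n)) t - X (Suc n) t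
        = integral {0..t} (\<lambda>s. F s (X (Suc n) s) - F s (X n s))"
      by (simp only: XS[of "Suc n" t] XS[of n t] add_diff_cancel_left
          Henstock_Kurzweil_Integration.integral_diff[OF iX[OF Suc.prems cX] iX[OF Suc.prems cX]])
    have "norm (X (Suc (Suc n)) t - X (Suc n) t) \<le> integral {0..t} (\<lambda>s. K * (C * (1/2)^n * exp (2 * K * s)))"
      unfolding eq
    proof (rule integral_norm_bound_integral)
      show "(\<lambda>s. F s (X (Suc n) s) - F s (X n s)) integrable_on {0..t}"
        by (intro integrable_diff iX Suc.prems cX)
      show "(\<lambda>s. K * (C * (1/2)^n * exp (2 * K * s))) integrable_on {0..t}"
        by (intro integrable_continuous_real continuous_intros)
      show "norm (F s (X (Suc n) s) - F s (X n s)) \<le> K * (C * (1/2)^n * exp (2 * K * s))"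
        if "s \<in> {0..t}" for s
      proof -
        have s: "s \<in> {0..b}" using that Suc.prems by auto
        have "norm (F s (X (Suc n) s) - F s (X n s)) \<le> K * norm (X (Suc n) s - X n s)"
          by (rule lip[OF s])
        also have "\<dots> \<le> K * (C * (1/2)^n * exp (2 * K * s))"
          using Suc.IH[OF s] K by (intro mult_left_mono) auto
        finally show ?thesis .
      qed
    qed
    also have "integral {0..t} (\<lambda>s. K * (C * (1/2)^n * exp (2 * K * s)))
        = C * (1/2)^Suc n * exp (2*K*t) - C * (1/2)^Suc n * exp (2*K*0)"
    proof (rule integral_unique, rule fundamental_theorem_of_calculus)
      show "0 \<le> t" using Suc.prems by auto
      show "((\<lambda>s. C * (1/2)^Suc n * exp (2 * K * s)) has_vector_derivative K * (C * (1/2)^n * exp (2 * K * s)))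
              (at s within {0..t})" for s
        unfolding has_real_derivative_iff_has_vector_derivative[symmetric]
        by (auto intro!: derivative_eq_intros)
    qed
    also have "\<dots> \<le> C * (1/2)^Suc n * exp (2*K*t)" using C0 by simp
    finally show ?case .
  qed
  have "uniformly_convergent_on {0..b} (\<lambda>n t. \<Sum>i<n. X (Suc i) t - X i t)"
  proof (rule Weierstrass_m_test')
    show "norm (X (Suc n) t - X n t) \<le> C * exp (2*K*b) * (1/2)^n" if "t \<in> {0..b}" for n t
    proof -
      have "C * (1/2)^n * exp (2 * K * t) \<le> C * (1/2)^n * exp (2 * K * b)"
        using that K C0 by (intro mult_left_mono) auto
      then show ?thesis using diff[OF that, of n] by (simp add: mult_ac)
    qed
    show "summable (\<lambda>n. C * exp (2*K*b) * (1/2)^n :: real)"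
      by (intro summable_mult summable_geometric) auto
  qed
  moreover have "(\<lambda>n t. \<Sum>i<n. X (Suc i) t - X i t) = (\<lambda>n t. X n t - x0)"
    using sum_lessThan_telescope[of "\<lambda>i. X i t" for t] by (intro ext) (simp only: X0)
  ultimately have "uniformly_convergent_on {0..b} (\<lambda>n t. X n t - x0)"
    by (simp only:)
  then obtain l where "uniform_limit {0..b} (\<lambda>n t. X n t - x0) l sequentially"
    unfolding uniformly_convergent_on_def by blast
  then have "uniform_limit {0..b} (\<lambda>n t. (X n t - x0) + x0) (\<lambda>t. l t + x0) sequentially"
    by (intro uniform_limit_intros)
  then obtain x where ul: "uniform_limit {0..b} X x sequentially"
    unfolding diff_add_cancel by blast
  have cx: "continuous_on {0..b} x"
    by (rule uniform_limit_theorem[OF _ ul]) (auto intro!: always_eventually cX)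
  have ptw: "(\<lambda>n. X n t) \<longlonglongrightarrow> x t" if "t \<in> {0..b}" for t
    using tendsto_uniform_limitI[OF ul that] .
  have ulF: "uniform_limit {0..b} (\<lambda>n t. F t (X n t)) (\<lambda>t. F t (x t)) sequentially"
  proof (rule uniform_limitI)
    fix \<epsilon> :: real assume "0 < \<epsilon>"
    then have "0 < \<epsilon> / K" using K by simp
    from uniform_limitD[OF ul this]
    show "\<forall>\<^sub>F n in sequentially. \<forall>t\<in>{0..b}. dist (F t (X n t)) (F t (x t)) < \<epsilon>"
    proof eventually_elim
      case (elim n)
      show ?case
      proof
        fix t assume t: "t \<in> {0..b}"
        have "dist (F t (X n t)) (F t (x t)) \<le> K * dist (X n t) (x t)"
          using lip[OF t] by (simp add: dist_norm)
        also have "\<dots> < K * (\<epsilon> / K)" using elim t K by (intro mult_strict_left_mono) auto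
        finally show "dist (F t (X n t)) (F t (x t)) < \<epsilon>" using K by simp
      qed
    qed
  qed
  have eq: "x t = x0 + integral {0..t} (\<lambda>s. F s (x s))" if t: "t \<in> {0..b}" for t
  proof -
    have "(\<lambda>n. integral {0..t} (\<lambda>s. F s (X n s))) \<longlonglongrightarrow> integral {0..t} (\<lambda>s. F s (x s))"
    proof -
      have "uniform_limit (cbox 0 t) (\<lambda>n t. F t (X n t)) (\<lambda>t. F t (x t)) sequentially"
        by (rule uniform_limit_on_subset[OF ulF]) (use t in auto)
      moreover have "continuous_on (cbox 0 t) (\<lambda>s. F s (X n s))" for n
        by (rule continuous_on_subset[OF cont[OF cX]]) (use t in auto)
      ultimately obtain I J where IJ: "\<And>n. ((\<lambda>s. F s (X n s)) has_integral I n) (cbox 0 t)"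
          "((\<lambda>s. F s (x s)) has_integral J) (cbox 0 t)" "(I \<longlongrightarrow> J) sequentially"
        by (rule uniform_limit_integral_cbox) auto
      then show ?thesis using integral_unique[OF IJ(1)] integral_unique[OF IJ(2)] by simp
    qed
    then have "(\<lambda>n. X (Suc n) t) \<longlonglongrightarrow> x0 + integral {0..t} (\<lambda>s. F s (x s))"
      unfolding XS by (intro tendsto_intros)
    moreover have "(\<lambda>n. X (Suc n) t) \<longlonglongrightarrow> x t" using ptw[OF t] by (rule LIMSEQ_Suc)
    ultimately show ?thesis by (rule LIMSEQ_unique[symmetric])
  qed
  have "x 0 = x0" using eq[of 0] b by simp
  moreover have "(x has_vector_derivative F t (x t)) (at t within {0..b})" if t: "t \<in> {0..b}" for t
  proof -
    have "((\<lambda>t. integral {0..t} (\<lambda>s. F s (x s))) has_vector_derivative F t (x t)) (at t within {0..b})"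
      by (rule integral_has_vector_derivative[OF cont[OF cx] t])
    then have "((\<lambda>t. x0 + integral {0..t} (\<lambda>s. F s (x s))) has_vector_derivative 0 + F t (x t)) (at t within {0..b})"
      by (intro derivative_intros)
    then have "((\<lambda>t. x0 + integral {0..t} (\<lambda>s. F s (x s))) has_vector_derivative F t (x t)) (at t within {0..b})"
      by simp
    then show ?thesis
      by (rule has_vector_derivative_transform[OF t, rotated]) (use eq in auto)
  qed
  ultimately show ?thesis by blast
qed

lemma DERIV_within_nonneg_imp_le:
  fixes f f' :: "real \<Rightarrow> real"
  assumes der: "\<And>u. u \<in> {a..b} \<Longrightarrow> (f has_real_derivative f' u) (at u within {a..b})"
    and nn: "\<And>u. u \<in> {x<..<y} \<Longrightarrow> 0 \<le> f' u"
    and xy: "a \<le> x" "x \<le> y" "y \<le> b"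
  shows "f x \<le> f y"
proof (rule DERIV_nonneg_imp_increasing_open[OF xy(2)])
  show "continuous_on {x..y} f"
    by (rule continuous_on_subset[OF DERIV_continuous_on[OF der]]) (use xy in auto)
  show "\<exists>l. (f has_real_derivative l) (at u) \<and> 0 \<le> l" if "x < u" "u < y" for u
  proof -
    have "u \<in> interior {a..b}" using that xy by auto
    then have "(f has_real_derivative f' u) (at u)"
      using der[of u] that xy at_within_interior[of u "{a..b}"] by (metis interior_subset subsetD)
    then show ?thesis using nn that by auto
  qed
qed

lemma DERIV_within_pos_imp_less:
  fixes f f' :: "real \<Rightarrow> real"
  assumes der: "\<And>u. u \<in> {a..b} \<Longrightarrow> (f has_real_derivative f' u) (at u within {a..b})"
    and pos: "\<And>u. u \<in> {x<..<y} \<Longrightarrow> 0 < f' u"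
    and xy: "a \<le> x" "x < y" "y \<le> b"
  shows "f x < f y"
proof (rule DERIV_pos_imp_increasing_open[OF xy(2)])
  show "continuous_on {x..y} f"
    by (rule continuous_on_subset[OF DERIV_continuous_on[OF der]]) (use xy in auto)
  show "\<exists>l. (f has_real_derivative l) (at u) \<and> 0 < l" if "x < u" "u < y" for u
  proof -
    have "u \<in> interior {a..b}" using that xy by auto
    then have "(f has_real_derivative f' u) (at u)"
      using der[of u] that xy at_within_interior[of u "{a..b}"] by (metis interior_subset subsetD)
    then show ?thesis using pos that by auto
  qed
qed

text \<open>\<open>V = |X|^2 + \<epsilon>^2\<close> absorbs the forcing:
  \<open>2 * \<epsilon> * norm X\<close> is at most \<open>\<epsilon>^2 + |X|^2\<close>, so
  \<open>|V'|\<close> is at most \<open>(2 * K + 1) * V\<close>. The estimate runs in both time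
  directions from \<open>t0\<close>. Without forcing it gives uniqueness, with small forcing
  continuity in the parameter.\<close>

lemma gronwall:
  fixes X X' :: "real \<Rightarrow> 'a::real_inner"
  assumes der: "\<And>t. t \<in> {a..b} \<Longrightarrow> (X has_vector_derivative X' t) (at t within {a..b})"
    and bnd: "\<And>t. t \<in> {a..b} \<Longrightarrow> norm (X' t) \<le> K * norm (X t) + \<epsilon>"
    and K: "0 \<le> K" and \<epsilon>: "0 \<le> \<epsilon>" and t0: "t0 \<in> {a..b}" and t: "t \<in> {a..b}"
  shows "(norm (X t))\<^sup>2 \<le> ((norm (X t0))\<^sup>2 + \<epsilon>\<^sup>2) * exp ((2*K+1) * \<bar>t - t0\<bar>)"
proof -
  define V where "V t = X t \<bullet> X t + \<epsilon>\<^sup>2" for t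
  define C where "C = 2*K+1"
  have dV: "(V has_real_derivative 2 * (X u \<bullet> X' u)) (at u within {a..b})" if "u \<in> {a..b}" for u
  proof -
    have "(V has_vector_derivative X u \<bullet> X' u + X' u \<bullet> X u + 0) (at u within {a..b})"
      unfolding V_def by (intro derivative_intros bounded_bilinear.has_vector_derivative[OF bounded_bilinear_inner] der that)
    then show ?thesis by (simp add: has_real_derivative_iff_has_vector_derivative inner_commute)
  qed
  have Vb: "\<bar>2 * (X u \<bullet> X' u)\<bar> \<le> C * V u" if "u \<in> {a..b}" for u
  proof -
    have "\<bar>X u \<bullet> X' u\<bar> \<le> norm (X u) * norm (X' u)" by (rule Cauchy_Schwarz_ineq2)
    also have "\<dots> \<le> norm (X u) * (K * norm (X u) + \<epsilon>)"
      by (intro mult_left_mono bnd that) auto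
    finally have 1: "\<bar>X u \<bullet> X' u\<bar> \<le> K * (norm (X u))\<^sup>2 + \<epsilon> * norm (X u)"
      by (simp add: algebra_simps power2_eq_square)
    have "2 * (\<epsilon> * norm (X u)) \<le> \<epsilon>\<^sup>2 + (norm (X u))\<^sup>2"
      using sum_squares_bound[of \<epsilon> "norm (X u)"] by simp
    moreover have "0 \<le> 2 * K * \<epsilon>\<^sup>2" using K by simp
    ultimately show ?thesis using 1
      unfolding V_def C_def power2_norm_eq_inner[symmetric] by (simp add: algebra_simps)
  qed
  have dG: "((\<lambda>u. V u * exp (c * u)) has_real_derivative (2 * (X u \<bullet> X' u) + c * V u) * exp (c*u)) (at u within {a..b})"
    if "u \<in> {a..b}" for u c
    by (rule derivative_eq_intros dV that refl | simp add: algebra_simps)+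
  have "V t \<le> V t0 * exp (C * \<bar>t - t0\<bar>)"
  proof (cases "t0 \<le> t")
    case True
    have "- (V t0 * exp (- C * t0)) \<le> - (V t * exp (- C * t))"
    proof (rule DERIV_within_nonneg_imp_le[where a = a and b = b and f = "\<lambda>u. - (V u * exp (- C * u))"])
      show "((\<lambda>u. - (V u * exp (- C * u))) has_real_derivative - ((2 * (X u \<bullet> X' u) + (- C) * V u) * exp (- C*u)))
          (at u within {a..b})" if "u \<in> {a..b}" for u
        by (intro DERIV_minus dG that)
      show "0 \<le> - ((2 * (X u \<bullet> X' u) + (- C) * V u) * exp (- C*u))" if "u \<in> {t0<..<t}" for u
        using Vb[of u] that t t0 by (simp add: mult_le_0_iff)
    qed (use True t t0 in auto)
    then have "V t * exp (- C * t) * exp (C * t) \<le> V t0 * exp (- C * t0) * exp (C * t)"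
      by (intro mult_right_mono) auto
    then have "V t \<le> V t0 * exp (- C * t0 + C * t)"
      by (simp add: mult.assoc flip: exp_add)
    then show ?thesis using True by (simp add: algebra_simps)
  next
    case False
    have "V t * exp (C * t) \<le> V t0 * exp (C * t0)"
    proof (rule DERIV_within_nonneg_imp_le[where a = a and b = b and f = "\<lambda>u. V u * exp (C * u)"])
      show "((\<lambda>u. V u * exp (C * u)) has_real_derivative (2 * (X u \<bullet> X' u) + C * V u) * exp (C*u))
          (at u within {a..b})" if "u \<in> {a..b}" for u
        by (intro dG that)
      show "0 \<le> (2 * (X u \<bullet> X' u) + C * V u) * exp (C*u)" if "u \<in> {t<..<t0}" for u
        using Vb[of u] that t t0 by (simp add: zero_le_mult_iff)
    qed (use False t t0 in auto)
    then have "V t * exp (C * t) * exp (- C * t) \<le> V t0 * exp (C * t0) * exp (- C * t)"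
      by (intro mult_right_mono) auto
    then have "V t \<le> V t0 * exp (C * t0 + - C * t)"
      by (simp add: mult.assoc flip: exp_add)
    then show ?thesis using False by (simp add: algebra_simps)
  qed
  moreover have "(norm (X t))\<^sup>2 \<le> V t" "V t0 = (norm (X t0))\<^sup>2 + \<epsilon>\<^sup>2"
    by (auto simp: V_def power2_norm_eq_inner)
  ultimately show ?thesis by (simp add: C_def)
qed

section \<open>Symplectic matrices of size four\<close>

definition symplectic4 :: "real^4^4 \<Rightarrow> bool" where
  "symplectic4 M \<longleftrightarrow> transpose M ** J4 ** M = J4"

text \<open>Since \<open>J4\<close> has inverse \<open>- J4\<close>, this is the conjugate by
  \<open>J4\<close> of the transpose, the inverse of a symplectic \<open>M\<close> in a form that is
  linear in the entries of \<open>M\<close>.\<close>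

definition sympl_inv :: "real^4^4 \<Rightarrow> real^4^4" where
  "sympl_inv M = - (J4 ** transpose M ** J4)"

definition lin_coeff :: "real^4^4 \<Rightarrow> real" where
  "lin_coeff M = M$1$1 + M$2$2 + M$3$3 + M$4$4"

text \<open>With \<open>c = lin_coeff M\<close> and \<open>d = const_coeff M\<close>, a symplectic
  \<open>M\<close> has characteristic polynomial \<open>z^4 - c z^3 + (d + 2) z^2 - c z + 1\<close>.
  The formula is the Pfaffian-type square root of \<open>det (M + sympl_inv M)\<close>.\<close>

definition const_coeff :: "real^4^4 \<Rightarrow> real" where
  "const_coeff M = (M$1$1 + M$3$3) * (M$2$2 + M$4$4) - (M$1$2 + M$4$3) * (M$2$1 + M$3$4)
     + (M$1$4 - M$2$3) * (M$3$2 - M$4$1)"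

lemma matrix_eq4: "(A::'a^4^4) = B \<longleftrightarrow>
  A$1$1 = B$1$1 \<and> A$1$2 = B$1$2 \<and> A$1$3 = B$1$3 \<and> A$1$4 = B$1$4 \<and>
  A$2$1 = B$2$1 \<and> A$2$2 = B$2$2 \<and> A$2$3 = B$2$3 \<and> A$2$4 = B$2$4 \<and>
  A$3$1 = B$3$1 \<and> A$3$2 = B$3$2 \<and> A$3$3 = B$3$3 \<and> A$3$4 = B$3$4 \<and>
  A$4$1 = B$4$1 \<and> A$4$2 = B$4$2 \<and> A$4$3 = B$4$3 \<and> A$4$4 = B$4$4"
  by (auto simp: vec_eq_iff forall_4)

lemma vector4_component [simp]:
  "(vector [a, b, c, d] :: 'a::zero^4) $ 1 = a"
  "(vector [a, b, c, d] :: 'a::zero^4) $ 2 = b"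
  "(vector [a, b, c, d] :: 'a::zero^4) $ 3 = c"
  "(vector [a, b, c, d] :: 'a::zero^4) $ 4 = d"
  by (simp_all add: vector_def)

lemma J4_component [simp]:
  "J4$1$1 = 0" "J4$1$2 = 0" "J4$1$3 = -1" "J4$1$4 = 0"
  "J4$2$1 = 0" "J4$2$2 = 0" "J4$2$3 = 0" "J4$2$4 = -1"
  "J4$3$1 = 1" "J4$3$2 = 0" "J4$3$3 = 0" "J4$3$4 = 0"
  "J4$4$1 = 0" "J4$4$2 = 1" "J4$4$3 = 0" "J4$4$4 = 0"
  by (simp_all add: J4_def)

lemma matrix_mult_component4: "((A::real^4^4) ** B)$i$j = A$i$1 * B$1$j + A$i$2 * B$2$j + A$i$3 * B$3$j + A$i$4 * B$4$j"
  by (simp add: matrix_matrix_mult_def sum_4)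

lemma neg_matrix_mult: "(- A :: real^'n^'n) ** B = - (A ** B)"
  by (simp add: vec_eq_iff matrix_matrix_mult_def sum_negf)

lemma J4_squared: "J4 ** J4 = - mat 1"
  by (simp add: matrix_eq4 matrix_mult_component4 mat_def)

lemma sympl_inv_left: assumes "symplectic4 M" shows "sympl_inv M ** M = mat 1"
proof -
  have "sympl_inv M ** M = - (J4 ** (transpose M ** J4 ** M))"
    by (simp add: sympl_inv_def neg_matrix_mult matrix_mul_assoc)
  also have "\<dots> = mat 1" using assms by (simp add: symplectic4_def J4_squared)
  finally show ?thesis .
qed

lemma sympl_inv_right: assumes "symplectic4 M" shows "M ** sympl_inv M = mat 1"
  using sympl_inv_left[OF assms] by (simp add: matrix_left_right_inverse)

lemma sum_inv_component:
  fixes M :: "real^4^4"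
  defines "N \<equiv> M + sympl_inv M"
  shows "N$1$1 = M$1$1 + M$3$3" "N$1$2 = M$1$2 + M$4$3" "N$1$3 = 0" "N$1$4 = M$1$4 - M$2$3"
    "N$2$1 = M$2$1 + M$3$4" "N$2$2 = M$2$2 + M$4$4" "N$2$3 = M$2$3 - M$1$4" "N$2$4 = 0"
    "N$3$1 = 0" "N$3$2 = M$3$2 - M$4$1" "N$3$3 = M$1$1 + M$3$3" "N$3$4 = M$2$1 + M$3$4"
    "N$4$1 = M$4$1 - M$3$2" "N$4$2 = 0" "N$4$3 = M$1$2 + M$4$3" "N$4$4 = M$2$2 + M$4$4"
  by (simp_all add: N_def sympl_inv_def matrix_mult_component4 transpose_def)

text \<open>\<open>M + M\<^sup>-\<^sup>1\<close> is skew-Hamiltonian, so its characteristic polynomial is the square of a quadratic,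
  which already annihilates it.\<close>

lemma sum_inv_squared:
  fixes M :: "real^4^4"
  defines "N \<equiv> M + sympl_inv M"
  shows "N ** N + mat (const_coeff M) = mat (lin_coeff M) ** N"
proof -
  note E = sum_inv_component[of M, folded N_def]
  show ?thesis
    unfolding matrix_eq4 vector_add_component matrix_mult_component4 E
    by (simp add: mat_def lin_coeff_def const_coeff_def algebra_simps)
qed

section \<open>Eigenvalues \<open>z\<close> of \<open>M\<close> and roots \<open>z + 1/z\<close> of
  the quadratic\<close>

abbreviation cmat :: "real^'n^'m \<Rightarrow> complex^'n^'m" where
  "cmat \<equiv> map_matrix complex_of_real"

lemma cmat_mult: "cmat (A ** B) = cmat A ** cmat B"
  by (simp add: vec_eq_iff matrix_matrix_mult_def)

lemma cmat_add: "cmat (A + B) = cmat A + cmat B"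
  by (simp add: vec_eq_iff)

lemma cmat_mat: "cmat (mat c) = mat (complex_of_real c)"
  by (simp add: vec_eq_iff mat_def)

lemma mat_vec: "mat c *v (v::'a::comm_semiring_1^'n) = c *s v"
  by (simp add: vec_eq_iff matrix_vector_mult_def mat_def if_distrib[of "\<lambda>x. x * _"] cong: if_cong)

lemma cspectrum_iff: "z \<in> cspectrum M \<longleftrightarrow> (\<exists>v. v \<noteq> 0 \<and> cmat M *v v = z *s v)"
proof -
  have "(cmat M - mat z) *v v = cmat M *v v - z *s v" for v
    by (simp only: matrix_vector_mult_diff_rdistrib mat_vec)
  then show ?thesis
    by (auto simp: cspectrum_def invertible_left_inverse matrix_left_invertible_ker)
qed

lemma matrix_vec_smult: "A *v (c *s v) = c *s (A *v (v::'a::comm_ring_1^'n))"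
  by (simp add: vec_eq_iff matrix_vector_mult_def sum_distrib_left mult_ac)

text \<open>An eigenvector of \<open>M\<close> for \<open>z\<close> is one of the inverse for
  \<open>1/z\<close>, hence one of \<open>M + M'\<close> for \<open>z + 1/z\<close>; on it the
  quadratic relation acts as a scalar.\<close>

lemma quadratic_of_eigenvalue:
  fixes M M' :: "complex^'n^'n"
  assumes inv: "M' ** M = mat 1"
    and quad: "(M + M') ** (M + M') + mat d = mat c ** (M + M')"
    and v: "v \<noteq> 0" and ev: "M *v v = z *s v"
  shows "z \<noteq> 0 \<and> (z + 1/z)\<^sup>2 - c * (z + 1/z) + d = 0"
proof -
  have Mv: "M' *v (z *s v) = v"
    using inv by (metis ev matrix_vector_mul_assoc matrix_vector_mul_lid)
  have z: "z \<noteq> 0" using Mv v by auto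
  have "M' *v v = (1/z) *s v"
    using arg_cong[OF Mv, of "\<lambda>w. (1/z) *s w"] z
    by (simp add: matrix_vec_smult vector_smult_assoc)
  then have "(M + M') *v v = (z + 1/z) *s v"
    by (simp add: matrix_vector_mult_add_rdistrib ev vector_sadd_rdistrib)
  then obtain N u where N: "N = M + M'" "u = z + 1/z" "N *v v = u *s v" by blast
  have "(N ** N + mat d) *v v = (mat c ** N) *v v" using quad by (simp add: N(1))
  then have "u *s (u *s v) + d *s v = c *s (u *s v)"
    by (simp add: matrix_vector_mult_add_rdistrib mat_vec matrix_vec_smult N(3)
        flip: matrix_vector_mul_assoc)
  then have "(u\<^sup>2 - c * u + d) *s v = 0"
    by (simp add: vec_eq_iff algebra_simps power2_eq_square)
  then have "u\<^sup>2 - c * u + d = 0" using v by (simp only: vector_mul_eq_0 simp_thms)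
  then show ?thesis using z N(2) by blast
qed

text \<open>Two factorizations give the converse. If \<open>u\<close>, \<open>u'\<close> are the
  roots, \<open>(N - u) (N - u') = 0\<close> yields an eigenvector \<open>w\<close> of
  \<open>N = M + M'\<close> for \<open>u\<close>; then \<open>(M - z) (M - 1/z) w = 0\<close> yields
  one of \<open>M\<close>, leaving open for which of \<open>z\<close> and
  \<open>1/z\<close>.\<close>

lemma eigenvalue_of_quadratic:
  fixes M M' :: "complex^'n^'n"
  assumes inv: "M ** M' = mat 1"
    and quad: "(M + M') ** (M + M') + mat d = mat c ** (M + M')"
    and tr: "2 * trace (M + M') = of_nat CARD('n) * c"
    and u: "u\<^sup>2 - c * u + d = 0" and z: "z\<^sup>2 - u * z + 1 = 0"
  shows "(\<exists>v. v \<noteq> 0 \<and> M *v v = z *s v) \<or> (\<exists>v. v \<noteq> 0 \<and> M *v v = (1/z) *s v)"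
proof -
  define N where "N = M + M'"
  define u' where "u' = c - u"
  have d: "d = u * u'" using u by (simp add: u'_def algebra_simps power2_eq_square)
  have z0: "z \<noteq> 0" using z by auto
  have NN: "N *v (N *v w) = c *s (N *v w) - d *s w" for w
  proof -
    have "(N ** N + mat d) *v w = (mat c ** N) *v w" using quad by (simp add: N_def)
    then show ?thesis
      by (simp add: matrix_vector_mult_add_rdistrib mat_vec eq_diff_eq flip: matrix_vector_mul_assoc)
  qed
  obtain w where w: "w \<noteq> 0" "N *v w = u *s w"
  proof (cases "\<exists>x. N *v x - u' *s x \<noteq> 0")
    case True
    then obtain x where x: "N *v x - u' *s x \<noteq> 0" by blast
    have "N *v (N *v x - u' *s x) = u *s (N *v x - u' *s x)"
      by (simp add: matrix_vector_mult_diff_distrib NN matrix_vec_smult)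
        (simp add: vec_eq_iff d u'_def algebra_simps)
    then show ?thesis using x that by blast
  next
    \<comment> \<open>Here \<open>N\<close> is the scalar \<open>u'\<close>. The trace hypothesis
      forces the double root \<open>u = u'\<close>, so \<open>u\<close> is still an
      eigenvalue.\<close>
    case False
    then have Nx: "N *v x = u' *s x" for x by simp
    then have "N = mat u'" by (simp add: matrix_eq mat_vec)
    then have "trace N = of_nat CARD('n) * u'" by (simp add: trace_def mat_def)
    then have "c = 2 * u'" using tr by (simp add: N_def)
    then have "u = u'" by (simp add: u'_def)
    then show ?thesis using Nx that[of "vec 1"] by (auto simp: vec_eq_iff)
  qed
  have "M *v (M *v w) + w = u *s (M *v w)"
    using arg_cong[OF w(2), of "\<lambda>x. M *v x"] inv
    by (simp add: N_def matrix_vector_mult_add_rdistrib matrix_vec_smult matrix_vector_mul_assoc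
        matrix_vector_right_distrib)
  then have MM: "M *v (M *v w) = u *s (M *v w) - w" by (simp add: eq_diff_eq)
  have uz: "u - 1/z = z" using z z0 by (simp add: field_simps power2_eq_square)
  show ?thesis
  proof (cases "M *v w - (1/z) *s w = 0")
    case True
    then show ?thesis using w by auto
  next
    case False
    have "M *v (M *v w - (1/z) *s w) = (u - 1/z) *s (M *v w) - w"
      by (simp add: matrix_vector_mult_diff_distrib MM matrix_vec_smult)
    also have "\<dots> = z *s (M *v w - (1/z) *s w)"
      using z0 by (simp add: uz vec_eq_iff algebra_simps)
    finally show ?thesis using False by blast
  qed
qed

lemma cspectrum_imp_quadratic:
  fixes z :: complex
  assumes M: "symplectic4 M" and z: "z \<in> cspectrum M"
  shows "z \<noteq> 0 \<and> (z + 1/z)\<^sup>2 - lin_coeff M * (z + 1/z) + const_coeff M = 0"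
proof -
  obtain v where v: "v \<noteq> 0" "cmat M *v v = z *s v" using z cspectrum_iff by blast
  have 1: "cmat (sympl_inv M) ** cmat M = mat 1"
    using sympl_inv_left[OF M] by (metis cmat_mat cmat_mult of_real_1)
  have 2: "(cmat M + cmat (sympl_inv M)) ** (cmat M + cmat (sympl_inv M)) + mat (complex_of_real (const_coeff M))
      = mat (complex_of_real (lin_coeff M)) ** (cmat M + cmat (sympl_inv M))"
    using arg_cong[OF sum_inv_squared[of M], of cmat] by (simp add: cmat_mult cmat_add cmat_mat)
  show ?thesis by (rule quadratic_of_eigenvalue[OF 1 2 v])
qed

lemma quadratic_imp_cspectrum:
  fixes u z :: complex
  assumes M: "symplectic4 M"
    and u: "u\<^sup>2 - lin_coeff M * u + const_coeff M = 0" and z: "z\<^sup>2 - u * z + 1 = 0"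
  shows "z \<in> cspectrum M \<or> 1/z \<in> cspectrum M"
proof -
  have "(\<exists>v. v \<noteq> 0 \<and> cmat M *v v = z *s v) \<or> (\<exists>v. v \<noteq> 0 \<and> cmat M *v v = (1/z) *s v)"
  proof (rule eigenvalue_of_quadratic[OF _ _ _ u z])
    show "cmat M ** cmat (sympl_inv M) = mat 1"
      using sympl_inv_right[OF M] by (metis cmat_mat cmat_mult of_real_1)
    show "(cmat M + cmat (sympl_inv M)) ** (cmat M + cmat (sympl_inv M)) + mat (complex_of_real (const_coeff M))
        = mat (complex_of_real (lin_coeff M)) ** (cmat M + cmat (sympl_inv M))"
      using arg_cong[OF sum_inv_squared[of M], of cmat] by (simp add: cmat_mult cmat_add cmat_mat)
    have "trace (cmat (M + sympl_inv M)) = 2 * complex_of_real (lin_coeff M)"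
      by (simp add: trace_def sum_4 sum_inv_component lin_coeff_def del: vector_add_component)
    then show "2 * trace (cmat M + cmat (sympl_inv M)) = of_nat CARD(4) * complex_of_real (lin_coeff M)"
      by (simp add: cmat_add)
  qed
  then show ?thesis by (simp add: cspectrum_iff)
qed

definition disc4 :: "real^4^4 \<Rightarrow> real" where
  "disc4 M = (lin_coeff M)\<^sup>2 - 4 * const_coeff M"

lemma add_inverse_real_of_circle_or_real:
  fixes z :: complex
  assumes "z \<in> sphere 0 1 \<union> \<real>"
  shows "z + 1/z \<in> \<real>"
proof (cases "z \<in> \<real>")
  case False
  then have "norm z = 1" using assms by auto
  then have "z * cnj z = 1" using complex_norm_square[of z] by simp
  then have "1/z = cnj z" by (cases "z = 0") (auto simp: field_simps)
  then show ?thesis by (simp add: complex_add_cnj)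
qed auto

text \<open>The two roots have product 1: they are real if \<open>|u|\<close> is at least 2, and
  otherwise conjugate, hence on the unit circle.\<close>

lemma ex_circle_or_real_root:
  fixes u :: real
  shows "\<exists>z::complex. z \<in> sphere 0 1 \<union> \<real> \<and> z\<^sup>2 - u * z + 1 = 0"
proof (cases "u\<^sup>2 \<ge> 4")
  case True
  define r where "r = (u + sqrt (u\<^sup>2 - 4)) / 2"
  have "r\<^sup>2 - u * r + 1 = 0"
    using True real_sqrt_pow2[of "u\<^sup>2 - 4"] by (simp add: r_def field_simps power2_eq_square)
  then have "complex_of_real (r\<^sup>2 - u * r + 1) = 0" by (simp only: of_real_0)
  then show ?thesis by (intro exI[of _ "complex_of_real r"]) simp
next
  case False
  define z where "z = Complex (u/2) (sqrt (4 - u\<^sup>2) / 2)"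
  have s: "(sqrt (4 - u\<^sup>2))\<^sup>2 = 4 - u\<^sup>2" using False by (intro real_sqrt_pow2) simp
  have "norm z = 1" using s by (simp add: z_def cmod_def power_divide field_simps)
  moreover have "z\<^sup>2 - u * z + 1 = 0"
    using s by (simp add: z_def complex_eq_iff power2_eq_square field_simps)
  ultimately show ?thesis by auto
qed

text \<open>For nonzero \<open>z\<close>, \<open>z + 1/z\<close> is real exactly when
  \<open>z\<close> is real or on the unit circle, so an eigenvalue there amounts to a real root of
  the quadratic. The union of line and circle is closed under \<open>1/z\<close>, so it does not
  matter which of \<open>z\<close> and \<open>1/z\<close> is the eigenvalue.\<close>

lemma complex_saddle_iff:
  assumes M: "symplectic4 M"
  shows "cspectrum M \<subseteq> - (sphere 0 1 \<union> \<real>) \<longleftrightarrow> disc4 M < 0"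
proof
  assume sub: "cspectrum M \<subseteq> - (sphere 0 1 \<union> \<real>)"
  show "disc4 M < 0"
  proof (rule ccontr)
    assume "\<not> disc4 M < 0"
    then have D: "0 \<le> disc4 M" by simp
    define u where "u = (lin_coeff M + sqrt (disc4 M)) / 2"
    have "u\<^sup>2 - lin_coeff M * u + const_coeff M = 0"
      using real_sqrt_pow2[OF D] by (simp add: u_def disc4_def field_simps power2_eq_square)
    then have "complex_of_real (u\<^sup>2 - lin_coeff M * u + const_coeff M) = 0" by (simp only: of_real_0)
    then have u: "(complex_of_real u)\<^sup>2 - lin_coeff M * complex_of_real u + const_coeff M = 0" by simp
    obtain z :: complex where z: "z \<in> sphere 0 1 \<union> \<real>" "z\<^sup>2 - u * z + 1 = 0"
      using ex_circle_or_real_root by blast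
    have "1/z \<in> sphere 0 1 \<union> \<real>" using z(1) by (auto simp: norm_divide)
    then show False using quadratic_imp_cspectrum[OF M u z(2)] z(1) sub by blast
  qed
next
  assume D: "disc4 M < 0"
  show "cspectrum M \<subseteq> - (sphere 0 1 \<union> \<real>)"
  proof
    fix z assume z: "z \<in> cspectrum M"
    show "z \<in> - (sphere 0 1 \<union> \<real>)"
    proof
      assume "z \<in> sphere 0 1 \<union> \<real>"
      then have "z + 1/z \<in> \<real>" by (rule add_inverse_real_of_circle_or_real)
      then obtain u where u: "z + 1/z = complex_of_real u" by (rule Reals_cases)
      have "complex_of_real (u\<^sup>2 - lin_coeff M * u + const_coeff M) = 0"
        using cspectrum_imp_quadratic[OF M z] unfolding u by simp
      then have "u\<^sup>2 - lin_coeff M * u + const_coeff M = 0" by (simp only: of_real_eq_0_iff)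
      then have "disc4 M = (2 * u - lin_coeff M)\<^sup>2"
        by (simp add: disc4_def algebra_simps power2_eq_square)
      then show False using D by simp
    qed
  qed
qed

lemma real_eigenvalue_cspectrum:
  assumes "v \<noteq> 0" "M *v v = c *s v"
  shows "complex_of_real c \<in> cspectrum M"
proof -
  define w :: "complex^'a" where "w = (\<chi> i. complex_of_real (v $ i))"
  have "w \<noteq> 0" using assms(1) by (auto simp: w_def vec_eq_iff)
  moreover have "cmat M *v w = of_real c *s w"
    using assms(2) by (simp add: w_def vec_eq_iff matrix_vector_mult_def flip: of_real_mult of_real_sum)
  ultimately show ?thesis by (auto simp: cspectrum_iff)
qed

lemma cspectrum_real_eigenvalue:
  fixes M :: "real^'n^'n"
  assumes "complex_of_real c \<in> cspectrum M"
  shows "\<exists>v. v \<noteq> 0 \<and> M *v v = c *s v"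
proof -
  obtain w where w: "w \<noteq> 0" "cmat M *v w = complex_of_real c *s w"
    using assms cspectrum_iff by blast
  define a b where "a = (\<chi> i. Re (w $ i))" and "b = (\<chi> i. Im (w $ i))"
  have "M *v a = c *s a" "M *v b = c *s b"
    using w(2) by (simp_all add: a_def b_def vec_eq_iff matrix_vector_mult_def complex_eq_iff)
  moreover have "a \<noteq> 0 \<or> b \<noteq> 0"
    using w(1) by (auto simp: a_def b_def vec_eq_iff complex_eq_iff)
  ultimately show ?thesis by blast
qed

text \<open>The only solution of \<open>z + 1/z = 2\<close> is \<open>z = 1\<close>, so a root of
  the quadratic at 2 would make 1 an eigenvalue.\<close>

lemma quadratic_at_2_nonzero:
  assumes M: "symplectic4 M" and no1: "\<And>v. M *v v = v \<Longrightarrow> v = 0"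
  shows "4 - 2 * lin_coeff M + const_coeff M \<noteq> 0"
proof
  assume "4 - 2 * lin_coeff M + const_coeff M = 0"
  then have "complex_of_real (4 - 2 * lin_coeff M + const_coeff M) = 0" by (simp only: of_real_0)
  then have "2\<^sup>2 - complex_of_real (lin_coeff M) * 2 + const_coeff M = 0" by (simp add: algebra_simps)
  then have "1 \<in> cspectrum M \<or> 1/1 \<in> cspectrum M"
    by (rule quadratic_imp_cspectrum[OF M]) simp
  then have "complex_of_real 1 \<in> cspectrum M" by simp
  then obtain v where "v \<noteq> 0" "M *v v = 1 *s v" using cspectrum_real_eigenvalue by blast
  then show False using no1[of v] by simp
qed

lemma quadratic_at_minus_2:
  assumes M: "symplectic4 M" and v: "v \<noteq> 0" "M *v v = - v"
  shows "4 + 2 * lin_coeff M + const_coeff M = 0"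
proof -
  have "M *v v = (-1) *s v" using v by simp
  then have "complex_of_real (-1) \<in> cspectrum M" using v real_eigenvalue_cspectrum by blast
  from cspectrum_imp_quadratic[OF M this] show ?thesis
    by (simp add: complex_eq_iff algebra_simps)
qed

section \<open>The fundamental solution\<close>

lemma bounded_bilinear_matrix_mult:
  "bounded_bilinear ((**) :: real^'n^'m \<Rightarrow> real^'p^'n \<Rightarrow> real^'p^'m)"
proof -
  have "bilinear ((**) :: real^'n^'m \<Rightarrow> real^'p^'n \<Rightarrow> real^'p^'m)"
    unfolding bilinear_def
    by (auto intro!: linearI simp: vec_eq_iff matrix_matrix_mult_def sum.distrib sum_distrib_left algebra_simps)
  then show ?thesis by (simp add: bilinear_conv_bounded_bilinear)
qed

lemma bounded_linear_transpose: "bounded_linear (transpose :: real^'n^'m \<Rightarrow> real^'m^'n)"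
  unfolding linear_conv_bounded_linear[symmetric]
  by (auto intro!: linearI simp: vec_eq_iff transpose_def)

definition coeff1 :: "real \<Rightarrow> real \<Rightarrow> real \<Rightarrow> real" where
  "coeff1 \<beta> e t = (2 * e * cos t - 1 - sqrt (9 - \<beta>)) / (2 * (1 + e * cos t))"

definition coeff2 :: "real \<Rightarrow> real \<Rightarrow> real \<Rightarrow> real" where
  "coeff2 \<beta> e t = (2 * e * cos t - 1 + sqrt (9 - \<beta>)) / (2 * (1 + e * cos t))"

lemma Bmat_component:
  "Bmat \<beta> e t $1$1 = 1" "Bmat \<beta> e t $1$2 = 0" "Bmat \<beta> e t $1$3 = 0" "Bmat \<beta> e t $1$4 = 1"
  "Bmat \<beta> e t $2$1 = 0" "Bmat \<beta> e t $2$2 = 1" "Bmat \<beta> e t $2$3 = -1" "Bmat \<beta> e t $2$4 = 0"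
  "Bmat \<beta> e t $3$1 = 0" "Bmat \<beta> e t $3$2 = -1" "Bmat \<beta> e t $3$3 = coeff1 \<beta> e t" "Bmat \<beta> e t $3$4 = 0"
  "Bmat \<beta> e t $4$1 = 1" "Bmat \<beta> e t $4$2 = 0" "Bmat \<beta> e t $4$3 = 0" "Bmat \<beta> e t $4$4 = coeff2 \<beta> e t"
  by (simp_all add: Bmat_def coeff1_def coeff2_def)

lemma ecc_pos: fixes e t :: real assumes "0 \<le> e" "e < 1" shows "0 < 1 + e * cos t"
proof -
  have "- e \<le> e * cos t" using mult_left_mono[of "-1" "cos t" e] assms by simp
  then show ?thesis using assms by linarith
qed

text \<open>\<open>\<beta>\<close> enters \<open>Bmat\<close> only through
  \<open>sqrt (9 - \<beta>)\<close>, and affinely; this is the coefficient of that root.\<close>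

definition Bdir :: "real \<Rightarrow> real \<Rightarrow> real^4^4" where
  "Bdir e t = vector [0, 0, vector [0, 0, - 1 / (2 * (1 + e * cos t)), 0],
                      vector [0, 0, 0, 1 / (2 * (1 + e * cos t))]]"

lemma Bdir_component:
  "Bdir e t $1$1 = 0" "Bdir e t $1$2 = 0" "Bdir e t $1$3 = 0" "Bdir e t $1$4 = 0"
  "Bdir e t $2$1 = 0" "Bdir e t $2$2 = 0" "Bdir e t $2$3 = 0" "Bdir e t $2$4 = 0"
  "Bdir e t $3$1 = 0" "Bdir e t $3$2 = 0" "Bdir e t $3$3 = - 1 / (2 * (1 + e * cos t))" "Bdir e t $3$4 = 0"
  "Bdir e t $4$1 = 0" "Bdir e t $4$2 = 0" "Bdir e t $4$3 = 0" "Bdir e t $4$4 = 1 / (2 * (1 + e * cos t))"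
  by (simp_all add: Bdir_def)

lemma Bmat_affine: "Bmat \<beta> e t = Bmat 9 e t + sqrt (9 - \<beta>) *\<^sub>R Bdir e t"
  by (simp add: matrix_eq4 Bmat_component Bdir_component coeff1_def coeff2_def
      diff_divide_distrib add_divide_distrib)

lemma continuous_on_matrix4:
  fixes A :: "real \<Rightarrow> real^4^4"
  assumes "\<And>i j. continuous_on S (\<lambda>t. A t $ i $ j)"
  shows "continuous_on S A"
proof -
  have "continuous_on S (\<lambda>t. \<chi> i j. A t $ i $ j)"
    by (intro continuous_on_vec_lambda assms)
  moreover have "(\<lambda>t. \<chi> i j. A t $ i $ j) = A" by (rule ext) (simp add: vec_eq_iff)
  ultimately show ?thesis by (simp only:)
qed

lemma continuous_on_Bmat:
  assumes "0 \<le> e" "e < 1"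
  shows "continuous_on S (Bmat \<beta> e)" "continuous_on S (Bdir e)"
proof -
  have nz: "2 * (1 + e * cos t) \<noteq> 0" for t using ecc_pos[OF assms, of t] by simp
  have "\<forall>i j. continuous_on S (\<lambda>t. Bmat \<beta> e t $ i $ j)"
    unfolding forall_4 Bmat_component coeff1_def coeff2_def
    by (intro conjI continuous_intros ballI nz)
  then show "continuous_on S (Bmat \<beta> e)" by (intro continuous_on_matrix4) blast
  have "\<forall>i j. continuous_on S (\<lambda>t. Bdir e t $ i $ j)"
    unfolding forall_4 Bdir_component
    by (intro conjI continuous_intros ballI nz)
  then show "continuous_on S (Bdir e)" by (intro continuous_on_matrix4) blast
qed

lemma continuous_on_Icc_bound:
  fixes A :: "real \<Rightarrow> 'a::real_normed_vector"
  assumes "continuous_on {a..b} A"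
  obtains C where "0 < C" "\<And>t. t \<in> {a..b} \<Longrightarrow> norm (A t) \<le> C"
proof -
  have "bounded (A ` {a..b})"
    by (intro compact_imp_bounded compact_continuous_image assms) auto
  then show ?thesis using that unfolding bounded_pos by blast
qed

lemma norm_matrix_mult_bound:
  obtains C :: real where "0 < C" "\<And>(A::real^'n^'m) (B::real^'p^'n). norm (A ** B) \<le> norm A * norm B * C"
  using bounded_bilinear.pos_bounded[OF bounded_bilinear_matrix_mult] by blast

lemma fundamental_solution_exists:
  assumes e: "0 \<le> e" "e < 1"
  shows "\<exists>g. is_fundamental_solution \<beta> e g"
proof -
  let ?A = "\<lambda>t. J4 ** Bmat \<beta> e t"
  have cA: "continuous_on {0..2*pi} ?A"
    by (intro bounded_bilinear.continuous_on[OF bounded_bilinear_matrix_mult] continuous_intros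
        continuous_on_Bmat e)
  obtain K where K: "0 < K" "\<And>t. t \<in> {0..2*pi} \<Longrightarrow> norm (?A t) \<le> K"
    using continuous_on_Icc_bound[OF cA] by blast
  obtain C where C: "0 < C" "\<And>(A::real^4^4) (B::real^4^4). norm (A ** B) \<le> norm A * norm B * C"
    using norm_matrix_mult_bound by blast
  have "\<exists>x. x 0 = mat 1 \<and> (\<forall>t\<in>{0..2*pi}. (x has_vector_derivative ?A t ** x t) (at t within {0..2*pi}))"
  proof (rule picard_global)
    show "continuous_on {0..2*pi} (\<lambda>t. ?A t ** x t)" if "continuous_on {0..2*pi} x" for x :: "real \<Rightarrow> real^4^4"
      by (rule bounded_bilinear.continuous_on[OF bounded_bilinear_matrix_mult cA that])
    show "norm (?A t ** x - ?A t ** y) \<le> (K * C) * norm (x - y)" if "t \<in> {0..2*pi}" for t and x y :: "real^4^4"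
    proof -
      have "norm (?A t ** x - ?A t ** y) = norm (?A t ** (x - y))"
        by (simp add: bounded_bilinear.diff_right[OF bounded_bilinear_matrix_mult])
      also have "\<dots> \<le> norm (?A t) * norm (x - y) * C" by (rule C(2))
      also have "\<dots> \<le> K * norm (x - y) * C" using K(2)[OF that] C(1) by (intro mult_right_mono) auto
      finally show ?thesis by (simp add: mult_ac)
    qed
  qed (use K C in auto)
  then show ?thesis by (simp add: is_fundamental_solution_def)
qed

lemma fundamental_solution:
  assumes "0 \<le> e" "e < 1"
  shows fundamental_solution_0: "fundamental_solution \<beta> e 0 = mat 1"
    and fundamental_solution_deriv: "t \<in> {0..2*pi} \<Longrightarrow>
      (fundamental_solution \<beta> e has_vector_derivative J4 ** Bmat \<beta> e t ** fundamental_solution \<beta> e t)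
        (at t within {0..2*pi})"
  using someI_ex[OF fundamental_solution_exists[OF assms, of \<beta>]]
  by (auto simp: fundamental_solution_def is_fundamental_solution_def)

text \<open>The derivative of \<open>transpose g ** J4 ** g\<close> cancels because
  \<open>Bmat\<close> is symmetric, \<open>J4 ** J4 = - mat 1\<close> and
  \<open>transpose J4 ** J4 = mat 1\<close>.\<close>

lemma fundamental_solution_symplectic:
  assumes e: "0 \<le> e" "e < 1" and t: "t \<in> {0..2*pi}"
  shows "symplectic4 (fundamental_solution \<beta> e t)"
proof -
  let ?g = "fundamental_solution \<beta> e"
  have JJ: "transpose J4 ** J4 = mat 1"
    by (simp add: matrix_eq4 matrix_mult_component4 transpose_def mat_def)
  have BT: "transpose (Bmat \<beta> e u) = Bmat \<beta> e u" for u
    by (simp add: matrix_eq4 transpose_def Bmat_component)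
  have "\<exists>c. \<forall>u\<in>{0..2*pi}. transpose (?g u) ** J4 ** ?g u = c"
  proof (rule has_vector_derivative_zero_constant)
    fix u assume u: "u \<in> {0..2*pi}"
    let ?g' = "J4 ** Bmat \<beta> e u ** ?g u"
    have "((\<lambda>u. transpose (?g u) ** J4 ** ?g u) has_vector_derivative
       (transpose (?g u) ** J4) ** ?g' + (transpose (?g u) ** 0 + transpose ?g' ** J4) ** ?g u) (at u within {0..2*pi})"
      by (intro bounded_bilinear.has_vector_derivative[OF bounded_bilinear_matrix_mult]
          bounded_linear.has_vector_derivative[OF bounded_linear_transpose]
          fundamental_solution_deriv[OF e u] has_vector_derivative_const)
    moreover have "transpose ?g' ** J4 = transpose (?g u) ** Bmat \<beta> e u ** (transpose J4 ** J4)"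
      by (simp add: matrix_transpose_mul BT matrix_mul_assoc)
    moreover have "(transpose (?g u) ** J4) ** ?g' = transpose (?g u) ** ((J4 ** J4) ** (Bmat \<beta> e u ** ?g u))"
      by (simp add: matrix_mul_assoc)
    ultimately show "((\<lambda>u. transpose (?g u) ** J4 ** ?g u) has_vector_derivative 0) (at u within {0..2*pi})"
      unfolding JJ J4_squared
      by (simp add: neg_matrix_mult bounded_bilinear.minus_right[OF bounded_bilinear_matrix_mult]
          bounded_bilinear.zero_right[OF bounded_bilinear_matrix_mult] matrix_mul_assoc)
  qed auto
  then have "transpose (?g t) ** J4 ** ?g t = transpose (?g 0) ** J4 ** ?g 0"
    using t by (metis atLeastAtMost_iff order.refl order.trans)
  then show ?thesis
    by (simp add: symplectic4_def fundamental_solution_0[OF e])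
qed

lemma sqrt_le_3: "0 \<le> \<beta> \<Longrightarrow> sqrt (9 - \<beta>) \<le> 3"
  using real_sqrt_le_mono[of "9 - \<beta>" 9] by simp

text \<open>Solutions for two parameters obey the same equation up to a forcing term proportional to
  the difference of the two values of \<open>sqrt (9 - \<beta>)\<close>. Gronwall's inequality needs
  only continuity of this root, so the endpoint 9 is included.\<close>

lemma continuous_on_fundamental_solution:
  assumes e: "0 \<le> e" "e < 1" and t: "t \<in> {0..2*pi}"
  shows "continuous_on {0..9} (\<lambda>\<beta>. fundamental_solution \<beta> e t)"
proof -
  let ?I = "{0..2*pi}"
  let ?g = "\<lambda>\<beta>. fundamental_solution \<beta> e"
  obtain C where C: "0 < C" "\<And>(A::real^4^4) (B::real^4^4). norm (A ** B) \<le> norm A * norm B * C"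
    using norm_matrix_mult_bound by blast
  have cA: "continuous_on ?I (\<lambda>t. J4 ** Bmat 9 e t)" "continuous_on ?I (\<lambda>t. J4 ** Bdir e t)"
    by (intro bounded_bilinear.continuous_on[OF bounded_bilinear_matrix_mult] continuous_intros
        continuous_on_Bmat e)+
  obtain K0 where K0: "0 < K0" "\<And>t. t \<in> ?I \<Longrightarrow> norm (J4 ** Bmat 9 e t) \<le> K0"
    using continuous_on_Icc_bound[OF cA(1)] by blast
  obtain K1 where K1: "0 < K1" "\<And>t. t \<in> ?I \<Longrightarrow> norm (J4 ** Bdir e t) \<le> K1"
    using continuous_on_Icc_bound[OF cA(2)] by blast
  have aff: "J4 ** Bmat \<beta> e u = J4 ** Bmat 9 e u + sqrt (9 - \<beta>) *\<^sub>R (J4 ** Bdir e u)" for \<beta> u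
    by (subst Bmat_affine)
      (simp add: bounded_bilinear.add_right[OF bounded_bilinear_matrix_mult]
        bounded_bilinear.scaleR_right[OF bounded_bilinear_matrix_mult])
  \<comment> \<open>The root is at most 3 on \<open>{0..9}\<close>, so one Lipschitz constant serves
    all parameters.\<close>
  define K where "K = (K0 + 3 * K1) * C"
  have KB: "norm (J4 ** Bmat \<beta> e u ** X) \<le> K * norm X" if "\<beta> \<in> {0..9}" "u \<in> ?I"
    for \<beta> u and X :: "real^4^4"
  proof -
    have "norm (J4 ** Bmat \<beta> e u) \<le> norm (J4 ** Bmat 9 e u) + norm (sqrt (9 - \<beta>) *\<^sub>R (J4 ** Bdir e u))"
      unfolding aff[of \<beta>] by (rule norm_triangle_ineq)
    also have "\<dots> \<le> K0 + 3 * K1"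
      using K0(2)[OF that(2)] K1(2)[OF that(2)] sqrt_le_3[of \<beta>] that(1) K1(1)
      by (auto intro!: add_mono mult_mono)
    finally have "norm (J4 ** Bmat \<beta> e u) * norm X * C \<le> (K0 + 3 * K1) * norm X * C"
      using C(1) by (intro mult_right_mono) auto
    then show ?thesis using C(2)[of "J4 ** Bmat \<beta> e u" X] by (simp add: K_def mult_ac)
  qed
  have K: "0 \<le> K" using K0(1) K1(1) C(1) by (simp add: K_def)
  show ?thesis
    unfolding continuous_on_def
  proof
    fix \<beta>0 :: real assume \<beta>0: "\<beta>0 \<in> {0..9}"
    have "continuous_on ?I (?g \<beta>0)"
      using fundamental_solution_deriv[OF e] by (rule continuous_on_vector_derivative)
    then obtain L where L: "0 < L" "\<And>t. t \<in> ?I \<Longrightarrow> norm (?g \<beta>0 t) \<le> L"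
      using continuous_on_Icc_bound by blast
    define E where "E \<beta> = \<bar>sqrt (9 - \<beta>) - sqrt (9 - \<beta>0)\<bar> * (K1 * L * C)" for \<beta>
    have bnd: "(norm (?g \<beta> t - ?g \<beta>0 t))\<^sup>2 \<le> (E \<beta>)\<^sup>2 * exp ((2 * K + 1) * \<bar>t - 0\<bar>)" if \<beta>: "\<beta> \<in> {0..9}" for \<beta>
    proof -
      let ?X' = "\<lambda>u. J4 ** Bmat \<beta> e u ** ?g \<beta> u - J4 ** Bmat \<beta>0 e u ** ?g \<beta>0 u"
      have "(norm (?g \<beta> t - ?g \<beta>0 t))\<^sup>2
        \<le> ((norm (?g \<beta> 0 - ?g \<beta>0 0))\<^sup>2 + (E \<beta>)\<^sup>2) * exp ((2 * K + 1) * \<bar>t - 0\<bar>)"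
      proof (rule gronwall[where a = 0 and b = "2*pi" and X' = ?X'])
        show "((\<lambda>u. ?g \<beta> u - ?g \<beta>0 u) has_vector_derivative ?X' u) (at u within ?I)" if "u \<in> ?I" for u
          by (intro derivative_intros fundamental_solution_deriv e that)
        show "norm (?X' u) \<le> K * norm (?g \<beta> u - ?g \<beta>0 u) + E \<beta>" if u: "u \<in> ?I" for u
        proof -
          have "?X' u = J4 ** Bmat \<beta> e u ** (?g \<beta> u - ?g \<beta>0 u)
              + (J4 ** Bmat \<beta> e u - J4 ** Bmat \<beta>0 e u) ** ?g \<beta>0 u"
            by (simp add: bounded_bilinear.diff_right[OF bounded_bilinear_matrix_mult]
                bounded_bilinear.diff_left[OF bounded_bilinear_matrix_mult])
          also have "J4 ** Bmat \<beta> e u - J4 ** Bmat \<beta>0 e u = (sqrt (9 - \<beta>) - sqrt (9 - \<beta>0)) *\<^sub>R (J4 ** Bdir e u)"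
            unfolding aff[of \<beta>] aff[of \<beta>0] by (simp add: algebra_simps)
          finally have eq: "?X' u = J4 ** Bmat \<beta> e u ** (?g \<beta> u - ?g \<beta>0 u)
              + (sqrt (9 - \<beta>) - sqrt (9 - \<beta>0)) *\<^sub>R (J4 ** Bdir e u ** ?g \<beta>0 u)"
            by (simp add: bounded_bilinear.scaleR_left[OF bounded_bilinear_matrix_mult])
          have "norm (J4 ** Bdir e u ** ?g \<beta>0 u) \<le> norm (J4 ** Bdir e u) * norm (?g \<beta>0 u) * C" by (rule C(2))
          also have "\<dots> \<le> K1 * L * C"
            using K1 L u C(1) by (intro mult_mono) auto
          finally have "norm ((sqrt (9 - \<beta>) - sqrt (9 - \<beta>0)) *\<^sub>R (J4 ** Bdir e u ** ?g \<beta>0 u)) \<le> E \<beta>"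
            unfolding E_def norm_scaleR by (intro mult_left_mono) auto
          then show ?thesis
            unfolding eq using KB[OF \<beta> u] by (intro norm_triangle_le add_mono) auto
        qed
        show "0 \<le> E \<beta>" using K1 L C by (simp add: E_def)
      qed (use K t in auto)
      then show ?thesis by (simp add: fundamental_solution_0[OF e])
    qed
    have cE: "continuous_on {0..9} (\<lambda>\<beta>. (E \<beta>)\<^sup>2 * exp ((2 * K + 1) * \<bar>t - 0\<bar>))"
      unfolding E_def by (intro continuous_intros)
    have E0: "(E \<beta>0)\<^sup>2 * exp ((2 * K + 1) * \<bar>t - 0\<bar>) = 0" by (simp add: E_def)
    have lim: "((\<lambda>\<beta>. (E \<beta>)\<^sup>2 * exp ((2 * K + 1) * \<bar>t - 0\<bar>)) \<longlongrightarrow> 0) (at \<beta>0 within {0..9})"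
      using bspec[OF cE[unfolded continuous_on_def] \<beta>0] unfolding E0 .
    have "((\<lambda>\<beta>. (norm (?g \<beta> t - ?g \<beta>0 t))\<^sup>2) \<longlongrightarrow> 0) (at \<beta>0 within {0..9})"
    proof (rule tendsto_sandwich[OF _ _ tendsto_const lim])
      show "\<forall>\<^sub>F \<beta> in at \<beta>0 within {0..9}. (norm (?g \<beta> t - ?g \<beta>0 t))\<^sup>2 \<le> (E \<beta>)\<^sup>2 * exp ((2 * K + 1) * \<bar>t - 0\<bar>)"
        unfolding eventually_at_filter by (intro always_eventually allI impI bnd)
    qed simp
    then have "((\<lambda>\<beta>. norm (?g \<beta> t - ?g \<beta>0 t)) \<longlongrightarrow> 0) (at \<beta>0 within {0..9})"
      using tendsto_real_sqrt by fastforce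
    then show "((\<lambda>\<beta>. ?g \<beta> t) \<longlongrightarrow> ?g \<beta>0 t) (at \<beta>0 within {0..9})"
      by (simp only: tendsto_norm_zero_iff Lim_null[of "\<lambda>\<beta>. ?g \<beta> t"])
  qed
qed

section \<open>Vector solutions, with momenta p1, p2 in components 1, 2 and positions q1, q2 in
  components 3, 4\<close>

definition solves :: "real \<Rightarrow> real \<Rightarrow> (real \<Rightarrow> real^4) \<Rightarrow> bool" where
  "solves \<beta> e x \<longleftrightarrow> (\<forall>t\<in>{0..2*pi}. (x has_vector_derivative (J4 ** Bmat \<beta> e t) *v x t) (at t within {0..2*pi}))"

lemma JB_vec_component:
  "((J4 ** Bmat \<beta> e t) *v v)$1 = v$2 - coeff1 \<beta> e t * v$3"
  "((J4 ** Bmat \<beta> e t) *v v)$2 = - v$1 - coeff2 \<beta> e t * v$4"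
  "((J4 ** Bmat \<beta> e t) *v v)$3 = v$1 + v$4"
  "((J4 ** Bmat \<beta> e t) *v v)$4 = v$2 - v$3"
  by (simp_all add: matrix_vector_mult_def sum_4 matrix_mult_component4 Bmat_component)

lemma solves_component:
  assumes "solves \<beta> e x" "t \<in> {0..2*pi}"
  shows "((\<lambda>t. x t $ 1) has_real_derivative x t $ 2 - coeff1 \<beta> e t * x t $ 3) (at t within {0..2*pi})"
    "((\<lambda>t. x t $ 2) has_real_derivative - x t $ 1 - coeff2 \<beta> e t * x t $ 4) (at t within {0..2*pi})"
    "((\<lambda>t. x t $ 3) has_real_derivative x t $ 1 + x t $ 4) (at t within {0..2*pi})"
    "((\<lambda>t. x t $ 4) has_real_derivative x t $ 2 - x t $ 3) (at t within {0..2*pi})"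
  unfolding has_real_derivative_iff_has_vector_derivative JB_vec_component[of \<beta> e t, symmetric]
  using assms unfolding solves_def
  by (auto intro!: bounded_linear.has_vector_derivative[OF bounded_linear_vec_nth])

lemma solvesI:
  fixes p1 p2 q1 q2 :: "real \<Rightarrow> real"
  assumes "\<And>t. t \<in> {0..2*pi} \<Longrightarrow> (p1 has_real_derivative p2 t - coeff1 \<beta> e t * q1 t) (at t within {0..2*pi})"
    "\<And>t. t \<in> {0..2*pi} \<Longrightarrow> (p2 has_real_derivative - p1 t - coeff2 \<beta> e t * q2 t) (at t within {0..2*pi})"
    "\<And>t. t \<in> {0..2*pi} \<Longrightarrow> (q1 has_real_derivative p1 t + q2 t) (at t within {0..2*pi})"
    "\<And>t. t \<in> {0..2*pi} \<Longrightarrow> (q2 has_real_derivative p2 t - q1 t) (at t within {0..2*pi})"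
  shows "solves \<beta> e (\<lambda>t. vector [p1 t, p2 t, q1 t, q2 t])"
  unfolding solves_def
proof
  fix t assume t: "t \<in> {0..2*pi}"
  have dec: "vector [a, b, c, d] = a *\<^sub>R axis 1 1 + b *\<^sub>R axis 2 1 + c *\<^sub>R axis 3 1 + d *\<^sub>R (axis 4 1 :: real^4)"
    for a b c d by (simp add: vec_eq_iff forall_4 axis_def)
  have rhs: "(J4 ** Bmat \<beta> e t) *v vector [p1 t, p2 t, q1 t, q2 t]
     = vector [p2 t - coeff1 \<beta> e t * q1 t, - p1 t - coeff2 \<beta> e t * q2 t, p1 t + q2 t, p2 t - q1 t]"
    by (simp add: vec_eq_iff forall_4 JB_vec_component)
  show "((\<lambda>t. vector [p1 t, p2 t, q1 t, q2 t]) has_vector_derivative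
      (J4 ** Bmat \<beta> e t) *v vector [p1 t, p2 t, q1 t, q2 t]) (at t within {0..2*pi})"
    unfolding rhs unfolding dec
    by (intro has_vector_derivative_add bounded_linear.has_vector_derivative[OF bounded_linear_scaleR_left]
        assms[OF t, unfolded has_real_derivative_iff_has_vector_derivative])
qed

lemma solves_diff: "solves \<beta> e x \<Longrightarrow> solves \<beta> e y \<Longrightarrow> solves \<beta> e (\<lambda>t. x t - y t)"
  unfolding solves_def by (auto intro!: derivative_eq_intros simp: matrix_vector_mult_diff_distrib)

lemma solves_add: "solves \<beta> e x \<Longrightarrow> solves \<beta> e y \<Longrightarrow> solves \<beta> e (\<lambda>t. x t + y t)"
  unfolding solves_def by (auto intro!: derivative_eq_intros simp: matrix_vector_right_distrib)

text \<open>Gronwall's inequality without forcing. The matching point \<open>t0\<close> is arbitrary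
  because later arguments compare solutions at \<open>pi\<close> and at
  \<open>pi / 2\<close>.\<close>

lemma solves_unique:
  assumes e: "0 \<le> e" "e < 1" and x: "solves \<beta> e x" and y: "solves \<beta> e y"
    and t0: "t0 \<in> {0..2*pi}" "x t0 = y t0" and t: "t \<in> {0..2*pi}"
  shows "x t = y t"
proof -
  have cA: "continuous_on {0..2*pi} (\<lambda>t. J4 ** Bmat \<beta> e t)"
    by (intro bounded_bilinear.continuous_on[OF bounded_bilinear_matrix_mult] continuous_intros
        continuous_on_Bmat e)
  obtain K where K: "0 < K" "\<And>t. t \<in> {0..2*pi} \<Longrightarrow> norm (J4 ** Bmat \<beta> e t) \<le> K"
    using continuous_on_Icc_bound[OF cA] by blast
  have "bilinear ((*v) :: real^4^4 \<Rightarrow> real^4 \<Rightarrow> real^4)"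
    unfolding bilinear_def
    by (auto intro!: linearI simp: vec_eq_iff matrix_vector_mult_def sum.distrib sum_distrib_left algebra_simps)
  then have "bounded_bilinear ((*v) :: real^4^4 \<Rightarrow> real^4 \<Rightarrow> real^4)"
    by (simp add: bilinear_conv_bounded_bilinear)
  then obtain C where C: "0 < C" "\<And>(A::real^4^4) (v::real^4). norm (A *v v) \<le> norm A * norm v * C"
    using bounded_bilinear.pos_bounded by blast
  have "(norm (x t - y t))\<^sup>2 \<le> ((norm (x t0 - y t0))\<^sup>2 + 0\<^sup>2) * exp ((2 * (K * C) + 1) * \<bar>t - t0\<bar>)"
  proof (rule gronwall[where a = 0 and b = "2*pi" and X' = "\<lambda>u. (J4 ** Bmat \<beta> e u) *v (x u - y u)"])
    show "((\<lambda>u. x u - y u) has_vector_derivative (J4 ** Bmat \<beta> e u) *v (x u - y u)) (at u within {0..2*pi})"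
      if "u \<in> {0..2*pi}" for u using solves_diff[OF x y] that by (simp add: solves_def)
    show "norm ((J4 ** Bmat \<beta> e u) *v (x u - y u)) \<le> K * C * norm (x u - y u) + 0" if "u \<in> {0..2*pi}" for u
    proof -
      have "norm (J4 ** Bmat \<beta> e u) * norm (x u - y u) * C \<le> K * norm (x u - y u) * C"
        using K(2)[OF that] C(1) by (intro mult_right_mono) auto
      then show ?thesis using C(2)[of "J4 ** Bmat \<beta> e u" "x u - y u"] by (simp add: mult_ac)
    qed
  qed (use K C t t0 in auto)
  then show ?thesis using t0 by simp
qed

lemma solves_fundamental:
  assumes e: "0 \<le> e" "e < 1"
  shows "solves \<beta> e (\<lambda>t. fundamental_solution \<beta> e t *v v)"
  unfolding solves_def
proof
  fix t assume t: "t \<in> {0..2*pi}"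
  have "bounded_linear (\<lambda>A::real^4^4. A *v v)"
    unfolding linear_conv_bounded_linear[symmetric]
    by (auto intro!: linearI simp: vec_eq_iff matrix_vector_mult_def sum.distrib sum_distrib_left algebra_simps)
  from bounded_linear.has_vector_derivative[OF this fundamental_solution_deriv[OF e t]]
  show "((\<lambda>t. fundamental_solution \<beta> e t *v v) has_vector_derivative
      (J4 ** Bmat \<beta> e t) *v (fundamental_solution \<beta> e t *v v)) (at t within {0..2*pi})"
    by (simp add: matrix_vector_mul_assoc)
qed

lemma solves_eq_fundamental:
  assumes e: "0 \<le> e" "e < 1" and x: "solves \<beta> e x" and t: "t \<in> {0..2*pi}"
  shows "x t = fundamental_solution \<beta> e t *v x 0"
  by (rule solves_unique[where ?t0.0 = 0, OF e x solves_fundamental[OF e] _ _ t])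
    (simp_all add: fundamental_solution_0[OF e])

section \<open>Variations of the Kepler ellipse\<close>

text \<open>A nondecreasing function with limit 0 at both ends is constant. This replaces
  integrating a Picone identity over an interval at whose ends the boundary term may exist only as a
  limit.\<close>

lemma DERIV_zero_of_vanishing_ends:
  fixes G G' :: "real \<Rightarrow> real"
  assumes der: "\<And>t. a < t \<Longrightarrow> t < b \<Longrightarrow> (G has_real_derivative G' t) (at t)"
    and nn: "\<And>t. a < t \<Longrightarrow> t < b \<Longrightarrow> 0 \<le> G' t"
    and lim: "(G \<longlongrightarrow> 0) (at_right a)" "(G \<longlongrightarrow> 0) (at_left b)"
    and t: "a < t" "t < b"
  shows "G' t = 0"
proof -
  have mono: "G u \<le> G w" if "a < u" "u \<le> w" "w < b" for u w
    by (rule DERIV_nonneg_imp_nondecreasing[OF that(2)]) (use der nn that in force)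
  have G0: "G u = 0" if u: "a < u" "u < b" for u
  proof (rule antisym)
    show "G u \<le> 0"
    proof (rule tendsto_lowerbound[OF lim(2)])
      show "\<forall>\<^sub>F w in at_left b. G u \<le> G w"
        using eventually_at_left_real[OF u(2)] by eventually_elim (use mono u in auto)
    qed simp
    show "0 \<le> G u"
    proof (rule tendsto_upperbound[OF lim(1)])
      show "\<forall>\<^sub>F w in at_right a. G w \<le> G u"
        using eventually_at_right_real[OF u(1)] by eventually_elim (use mono u in auto)
    qed simp
  qed
  have "((\<lambda>u. 0) has_real_derivative G' t) (at t)"
    by (rule has_field_derivative_transform_within_open[OF der[OF t], of "{a<..<b}"]) (use t G0 in auto)
  then show ?thesis using DERIV_unique DERIV_const by blast
qed

text \<open>The numerator vanishes to higher order than the denominator, as is seen by dividing both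
  by \<open>t - a\<close>.\<close>

lemma quotient_tendsto_0_right:
  fixes n d :: "real \<Rightarrow> real"
  assumes n: "(n has_real_derivative 0) (at a within {a..b})" "n a = 0"
    and d: "(d has_real_derivative d') (at a within {a..b})" "d a = 0" "d' \<noteq> 0"
    and ab: "a < b"
  shows "((\<lambda>t. n t / d t) \<longlongrightarrow> 0) (at_right a)"
proof -
  have "((\<lambda>t. (n t - n a) / (t - a)) \<longlongrightarrow> 0) (at a within {a..b})"
    "((\<lambda>t. (d t - d a) / (t - a)) \<longlongrightarrow> d') (at a within {a..b})"
    using n(1) d(1) by (simp_all add: has_field_derivative_iff)
  then have "((\<lambda>t. ((n t - n a) / (t - a)) / ((d t - d a) / (t - a))) \<longlongrightarrow> 0 / d') (at a within {a..b})"
    using d(3) by (intro tendsto_divide)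
  then have "((\<lambda>t. ((n t - n a) / (t - a)) / ((d t - d a) / (t - a))) \<longlongrightarrow> 0) (at_right a)"
    using at_within_Icc_at_right[OF ab] by simp
  moreover have "\<forall>\<^sub>F t in at_right a. ((n t - n a) / (t - a)) / ((d t - d a) / (t - a)) = n t / d t"
    using eventually_at_right_less[of a] by eventually_elim (simp add: n d)
  ultimately show ?thesis by (rule Lim_transform_eventually)
qed

lemma quotient_tendsto_0_left:
  fixes n d :: "real \<Rightarrow> real"
  assumes n: "(n has_real_derivative 0) (at b within {a..b})" "n b = 0"
    and d: "(d has_real_derivative d') (at b within {a..b})" "d b = 0" "d' \<noteq> 0"
    and ab: "a < b"
  shows "((\<lambda>t. n t / d t) \<longlongrightarrow> 0) (at_left b)"
proof -
  have "((\<lambda>t. (n t - n b) / (t - b)) \<longlongrightarrow> 0) (at b within {a..b})"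
    "((\<lambda>t. (d t - d b) / (t - b)) \<longlongrightarrow> d') (at b within {a..b})"
    using n(1) d(1) by (simp_all add: has_field_derivative_iff)
  then have "((\<lambda>t. ((n t - n b) / (t - b)) / ((d t - d b) / (t - b))) \<longlongrightarrow> 0 / d') (at b within {a..b})"
    using d(3) by (intro tendsto_divide)
  then have "((\<lambda>t. ((n t - n b) / (t - b)) / ((d t - d b) / (t - b))) \<longlongrightarrow> 0) (at_left b)"
    using at_within_Icc_at_left[OF ab] by simp
  moreover have "\<forall>\<^sub>F t in at_left b. ((n t - n b) / (t - b)) / ((d t - d b) / (t - b)) = n t / d t"
    using eventually_at_left_real[OF ab] by eventually_elim (simp add: n d)
  ultimately show ?thesis by (rule Lim_transform_eventually)
qed

text \<open>By the area law, physical time grows like the squared radius, and on the ellipse the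
  radius is a multiple of \<open>1 / (1 + e * cos t)\<close>.\<close>

definition ktime :: "real \<Rightarrow> real \<Rightarrow> real" where
  "ktime e t = integral {0..t} (\<lambda>u. 1 / (1 + e * cos u)\<^sup>2)"

lemma ktime_0 [simp]: "ktime e 0 = 0"
  by (simp add: ktime_def)

lemma ktime_deriv:
  assumes e: "0 \<le> e" "e < 1" and t: "t \<in> {0..2*pi}"
  shows "(ktime e has_real_derivative 1 / (1 + e * cos t)\<^sup>2) (at t within {0..2*pi})"
proof -
  have nz: "(1 + e * cos u)\<^sup>2 \<noteq> 0" for u using ecc_pos[OF e, of u] by simp
  have "continuous_on {0..2*pi} (\<lambda>u. 1 / (1 + e * cos u)\<^sup>2)"
    by (intro continuous_intros ballI nz)
  from integral_has_vector_derivative[OF this t] show ?thesis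
    by (simp add: has_real_derivative_iff_has_vector_derivative ktime_def[abs_def])
qed

lemma ktime_pos:
  assumes e: "0 \<le> e" "e < 1" and t: "0 < t" "t \<le> 2*pi"
  shows "0 < ktime e t"
proof -
  have pos: "0 < 1 / (1 + e * cos u)\<^sup>2" for u using ecc_pos[OF e, of u] by simp
  have "ktime e 0 < ktime e t"
    by (rule DERIV_within_pos_imp_less[where a = 0 and b = "2*pi", OF ktime_deriv[OF e] pos])
      (use t in auto)
  then show ?thesis by simp
qed

text \<open>Position components of two solutions at \<open>\<beta> = 0\<close>, in coordinates rotating and pulsating with the Kepler ellipse:
  \<open>ecc\<close> comes from varying the eccentricity, \<open>scal\<close> from the scaling symmetry of the Kepler problem. The latter
  is not periodic, as it contains the physical time \<open>ktime\<close> as a function of the true anomaly.\<close>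

definition ecc_q1 :: "real \<Rightarrow> real \<Rightarrow> real" where "ecc_q1 e t = (1 + e * cos t) * cos t"
definition ecc_q2 :: "real \<Rightarrow> real \<Rightarrow> real" where "ecc_q2 e t = - sin t * (2 + e * cos t)"
definition ecc_q1_deriv :: "real \<Rightarrow> real \<Rightarrow> real" where "ecc_q1_deriv e t = - sin t * (1 + 2 * e * cos t)"
definition scal_q1 :: "real \<Rightarrow> real \<Rightarrow> real" where
  "scal_q1 e t = 1 - 3/2 * e * ktime e t * (1 + e * cos t) * sin t"
definition scal_q2 :: "real \<Rightarrow> real \<Rightarrow> real" where "scal_q2 e t = - 3/2 * ktime e t * (1 + e * cos t)\<^sup>2"
definition scal_q1_deriv :: "real \<Rightarrow> real \<Rightarrow> real" where
  "scal_q1_deriv e t = - 3/2 * e * (sin t / (1 + e * cos t) + ktime e t * ((1 + e * cos t) * cos t - e * (sin t)\<^sup>2))"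
definition kpot :: "real \<Rightarrow> real \<Rightarrow> real" where "kpot e t = 3 / (1 + e * cos t) - 4"

lemma sin_sq: "sin t * sin t = 1 - cos t * cos (t::real)"
  using sin_cos_squared_add[of t] by (simp add: power2_eq_square algebra_simps)

text \<open>Variations at \<open>\<beta> = 0\<close> conserve \<open>q2' + 2 q1\<close>; the
  constant is \<open>e\<close> for the first solution and \<open>1/2\<close> for the second. With
  this constant called \<open>c\<close>, what remains is
  \<open>q1'' = kpot q1 + 2 c\<close>.\<close>

lemma kepler_derivs:
  assumes e: "0 \<le> e" "e < 1" and t: "t \<in> {0..2*pi}"
  shows "(ecc_q1 e has_real_derivative ecc_q1_deriv e t) (at t within {0..2*pi})"
    "(ecc_q2 e has_real_derivative e - 2 * ecc_q1 e t) (at t within {0..2*pi})"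
    "(ecc_q1_deriv e has_real_derivative kpot e t * ecc_q1 e t + 2 * e) (at t within {0..2*pi})"
    "(scal_q1 e has_real_derivative scal_q1_deriv e t) (at t within {0..2*pi})"
    "(scal_q2 e has_real_derivative 1/2 - 2 * scal_q1 e t) (at t within {0..2*pi})"
    "(scal_q1_deriv e has_real_derivative kpot e t * scal_q1 e t + 1) (at t within {0..2*pi})"
proof -
  have f: "1 + e * cos t \<noteq> 0" using ecc_pos[OF e, of t] by simp
  \<comment> \<open>\<open>kpot\<close> always meets a factor \<open>1 + e * cos t\<close> that
    cancels its denominator.\<close>
  have k: "kpot e t * ((1 + e * cos t) * z) = 3 * z - 4 * (1 + e * cos t) * z" for z
    using f by (simp add: kpot_def algebra_simps) (simp add: field_simps)
  note S = sin_sq[of t]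
  have S': "sin t * (sin t * z) = z - cos t * cos t * z" for z
    using S by (metis left_diff_distrib mult.assoc mult_1)
  show "(ecc_q1 e has_real_derivative ecc_q1_deriv e t) (at t within {0..2*pi})"
    unfolding ecc_q1_def[abs_def] ecc_q1_deriv_def by (auto intro!: derivative_eq_intros simp: algebra_simps)
  show "(ecc_q2 e has_real_derivative e - 2 * ecc_q1 e t) (at t within {0..2*pi})"
    unfolding ecc_q2_def[abs_def] ecc_q1_def by (auto intro!: derivative_eq_intros simp: algebra_simps S S')
  show "(ecc_q1_deriv e has_real_derivative kpot e t * ecc_q1 e t + 2 * e) (at t within {0..2*pi})"
    unfolding ecc_q1_deriv_def[abs_def] ecc_q1_def k[of "cos t"]
    by (auto intro!: derivative_eq_intros simp: algebra_simps S S')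
  show "(scal_q1 e has_real_derivative scal_q1_deriv e t) (at t within {0..2*pi})"
  proof -
    have "((\<lambda>t. (1 + e * cos t) * sin t) has_real_derivative (1 + e * cos t) * cos t - e * (sin t)\<^sup>2) (at t within {0..2*pi})"
      by (auto intro!: derivative_eq_intros simp: power2_eq_square)
    note der = DERIV_diff[OF DERIV_const DERIV_cmult[OF DERIV_mult[OF ktime_deriv[OF e t] this], of "3/2 * e"], of 1]
    have "1 / (1 + e * cos t)\<^sup>2 * ((1 + e * cos t) * sin t) = sin t / (1 + e * cos t)"
      using f by (simp add: power2_eq_square)
    then have val: "0 - 3/2 * e * (1 / (1 + e * cos t)\<^sup>2 * ((1 + e * cos t) * sin t)
        + ((1 + e * cos t) * cos t - e * (sin t)\<^sup>2) * ktime e t) = scal_q1_deriv e t"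
      by (simp only: scal_q1_deriv_def) (simp add: algebra_simps)
    have "scal_q1 e = (\<lambda>t. 1 - 3/2 * e * (ktime e t * ((1 + e * cos t) * sin t)))"
      by (rule ext) (simp add: scal_q1_def)
    then show ?thesis using DERIV_cong[OF der val] by (simp only:)
  qed
  show "(scal_q2 e has_real_derivative 1/2 - 2 * scal_q1 e t) (at t within {0..2*pi})"
  proof -
    have "((\<lambda>t. (1 + e * cos t)\<^sup>2) has_real_derivative - 2 * e * sin t * (1 + e * cos t)) (at t within {0..2*pi})"
      by (auto intro!: derivative_eq_intros)
    note DERIV_cmult[OF DERIV_mult[OF ktime_deriv[OF e t] this], of "- 3/2"]
    moreover have "- 3/2 * (1 / (1 + e * cos t)\<^sup>2 * (1 + e * cos t)\<^sup>2 + - 2 * e * sin t * (1 + e * cos t) * ktime e t)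
        = 1/2 - 2 * scal_q1 e t"
      using f by (simp add: scal_q1_def algebra_simps)
    ultimately show ?thesis unfolding scal_q2_def[abs_def] by (simp add: mult.assoc)
  qed
  show "(scal_q1_deriv e has_real_derivative kpot e t * scal_q1 e t + 1) (at t within {0..2*pi})"
  proof -
    have "((\<lambda>t. (1 + e * cos t) * cos t - e * (sin t)\<^sup>2) has_real_derivative - sin t * (1 + 4 * e * cos t)) (at t within {0..2*pi})"
      by (auto intro!: derivative_eq_intros simp: algebra_simps)
    note der = DERIV_mult[OF ktime_deriv[OF e t] this]
    have "((\<lambda>t. sin t / (1 + e * cos t)) has_real_derivative (cos t + e) / (1 + e * cos t)\<^sup>2) (at t within {0..2*pi})"
      using f by (auto intro!: derivative_eq_intros simp: algebra_simps S S' power2_eq_square)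
    note der = DERIV_cmult[OF DERIV_add[OF this der], of "- 3/2 * e"]
    \<comment> \<open>The terms free of \<open>ktime\<close> collapse to
      \<open>kpot e t + 1\<close>, by facts \<open>1\<close> and \<open>2\<close>; those containing
      \<open>ktime\<close> are matched by \<open>k\<close>.\<close>
    have "(cos t + e) / (1 + e * cos t)\<^sup>2 + 1 / (1 + e * cos t)\<^sup>2 * ((1 + e * cos t) * cos t - e * (sin t)\<^sup>2)
        = (2 * cos t * (1 + e * cos t)) / (1 + e * cos t)\<^sup>2"
      by (simp add: add_divide_distrib[symmetric] algebra_simps S S' power2_eq_square)
    also have "\<dots> = 2 * cos t / (1 + e * cos t)" using f by (simp add: power2_eq_square)
    finally have 1: "- 3/2 * e * ((cos t + e) / (1 + e * cos t)\<^sup>2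
          + 1 / (1 + e * cos t)\<^sup>2 * ((1 + e * cos t) * cos t - e * (sin t)\<^sup>2)) = - 3 * e * cos t / (1 + e * cos t)"
      by simp
    have 2: "kpot e t + 1 = - 3 * e * cos t / (1 + e * cos t)"
      using f by (simp add: kpot_def field_simps)
    have "kpot e t * scal_q1 e t + 1 = kpot e t + 1 - 3/2 * e * ktime e t * (kpot e t * ((1 + e * cos t) * sin t))"
      by (simp add: scal_q1_def algebra_simps)
    also have "\<dots> = - 3/2 * e * ((cos t + e) / (1 + e * cos t)\<^sup>2
          + (1 / (1 + e * cos t)\<^sup>2 * ((1 + e * cos t) * cos t - e * (sin t)\<^sup>2) + - sin t * (1 + 4 * e * cos t) * ktime e t))"
      unfolding k 2 1[symmetric] by (simp add: algebra_simps)
    finally show ?thesis using der unfolding scal_q1_deriv_def[abs_def] by simp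
  qed
qed

text \<open>The two solutions span a Lagrangian subspace, as needed for the Picone identity.\<close>

lemma kepler_isotropic:
  assumes e: "0 \<le> e" "e < 1"
  shows "ecc_q1 e t * scal_q1_deriv e t - ecc_q1_deriv e t * scal_q1 e t + ecc_q2 e t / 2 - e * scal_q2 e t = 0"
proof -
  have f: "1 + e * cos t \<noteq> 0" using ecc_pos[OF e, of t] by simp
  \<comment> \<open>\<open>q\<close> abstracts the only quotient; once multiplied by
    \<open>1 + e * cos t\<close> it disappears, and the claim becomes a polynomial identity.\<close>
  obtain q where q: "sin t / (1 + e * cos t) = q" "(1 + e * cos t) * q = sin t" using f by simp
  have "ecc_q1 e t * scal_q1_deriv e t = - 3/2 * e * cos t * (sin t + ktime e t * (1 + e * cos t) * ((1 + e * cos t) * cos t - e * (sin t)\<^sup>2))"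
  proof -
    have "ecc_q1 e t * scal_q1_deriv e t = - 3/2 * e * cos t * ((1 + e * cos t) * q
        + ktime e t * (1 + e * cos t) * ((1 + e * cos t) * cos t - e * (sin t)\<^sup>2))"
      unfolding ecc_q1_def scal_q1_deriv_def q(1) by (simp add: algebra_simps add_divide_distrib)
    then show ?thesis unfolding q(2) .
  qed
  moreover have "(sin t)\<^sup>2 = 1 - (cos t)\<^sup>2" by (rule sin_squared_eq)
  ultimately show ?thesis unfolding ecc_q1_deriv_def scal_q1_def ecc_q2_def scal_q2_def by algebra
qed

section \<open>Positivity on (0, pi] of the determinant formed by the positions of the two Kepler
  solutions\<close>

definition kdet :: "real \<Rightarrow> real \<Rightarrow> real" where "kdet e t = ecc_q1 e t * scal_q2 e t - ecc_q2 e t * scal_q1 e t"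

lemma kdet_eq: "kdet e t = sin t * (2 + e * cos t)
    - 3/2 * ktime e t * ((1 + e * cos t) * (2 * e + (1 + e\<^sup>2) * cos t))"
  using sin_squared_eq[of t] unfolding kdet_def ecc_q1_def ecc_q2_def scal_q1_def scal_q2_def by algebra

text \<open>At \<open>x = cos u\<close> this is, up to positive factors, the derivative of the
  auxiliary function \<open>W\<close> in \<open>kdet_pos\<close>. For negative \<open>x\<close>,
  splitting off the factors \<open>1 - y\<close> and \<open>1 - e\<close> makes both summands
  visibly nonnegative.\<close>

lemma kdet_poly_pos:
  fixes e x :: real
  assumes e: "0 \<le> e" "e < 1" and x: "-1 < x" "x \<le> 1"
  shows "0 < 2 + 2 * e * x - e * x^3 - (3/2 - e\<^sup>2/2) * x\<^sup>2"
proof (cases "0 \<le> x")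
  case True
  have x2: "x\<^sup>2 \<le> 1" using True x by (simp add: power_le_one)
  have "0 \<le> e * x * (2 - x\<^sup>2)" using e True x2 by simp
  moreover have "0 \<le> e\<^sup>2 * x\<^sup>2" by simp
  moreover have "2 + 2 * e * x - e * x^3 - (3/2 - e\<^sup>2/2) * x\<^sup>2
      = 2 - 3/2 * x\<^sup>2 + e * x * (2 - x\<^sup>2) + e\<^sup>2 * x\<^sup>2 / 2"
    by (simp add: field_simps power2_eq_square power3_eq_cube)
  ultimately show ?thesis using x2 by linarith
next
  case False
  define y where "y = - x"
  have y: "0 \<le> y" "y < 1" using False x by (auto simp: y_def)
  have y2: "y\<^sup>2 < 1" using y by (simp add: power_less_one_iff abs_square_less_1)
  have "(1 + e) * y \<le> 2 * 1" using e y by (intro mult_mono) auto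
  then have "0 \<le> 2 - y\<^sup>2 - (1 + e) * y / 2" using y2 by linarith
  then have "0 \<le> (1 - e) * y * (2 - y\<^sup>2 - (1 + e) * y / 2)" using e y by simp
  moreover have "0 < (1 - y) * (2 - y\<^sup>2)" using y y2 by simp
  moreover have "2 + 2 * e * x - e * x^3 - (3/2 - e\<^sup>2/2) * x\<^sup>2
      = (1 - y) * (2 - y\<^sup>2) + (1 - e) * y * (2 - y\<^sup>2 - (1 + e) * y / 2)"
    by (simp add: y_def field_simps power2_eq_square power3_eq_cube)
  ultimately show ?thesis by linarith
qed

text \<open>This is what allows arbitrary positions to be expanded in the two Kepler solutions. If
  \<open>K t\<close> is not positive, both terms of \<open>kdet\<close> have the right sign.
  Otherwise \<open>K\<close> is positive on all of \<open>{0..t}\<close>, since it decreases up to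
  \<open>pi\<close>; dividing by \<open>(1 + e * cos t) * K t\<close> turns the claim into
  \<open>W t > 0\<close>, where \<open>W\<close> starts at 0 and increases.\<close>

lemma kdet_pos:
  assumes e: "0 \<le> e" "e < 1" and t: "0 < t" "t \<le> pi"
  shows "0 < kdet e t"
proof -
  define K where "K u = 2 * e + (1 + e\<^sup>2) * cos u" for u
  have T: "0 < ktime e t" using ktime_pos[OF e] t by simp
  have f: "0 < 1 + e * cos u" for u by (rule ecc_pos[OF e])
  have N: "0 < 2 + e * cos u" for u using f[of u] by linarith
  have s0: "0 \<le> sin t" using t by (intro sin_ge_zero) auto
  have kd: "kdet e t = sin t * (2 + e * cos t) - 3/2 * ktime e t * ((1 + e * cos t) * K t)"
    by (simp add: kdet_eq K_def)
  consider "K t < 0" | "K t = 0" | "0 < K t" by linarith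
  then show ?thesis
  proof cases
    case 1
    have "0 < ktime e t * ((1 + e * cos t) * (- K t))" using 1 T f[of t] by (intro mult_pos_pos) auto
    moreover have "0 \<le> sin t * (2 + e * cos t)" using s0 N[of t] by simp
    ultimately show ?thesis unfolding kd by simp
  next
    case 2
    have "t \<noteq> pi"
    proof
      assume "t = pi"
      then have "(1 - e)\<^sup>2 = 0" using 2 by (simp add: K_def power2_eq_square algebra_simps)
      then show False using e by simp
    qed
    then have "0 < sin t" using t by (intro sin_gt_zero) auto
    then show ?thesis unfolding kd using 2 N by simp
  next
    case 3
    have e2: "0 < 1 + e\<^sup>2" by (simp add: add_pos_nonneg)
    have Ku: "0 < K u" if "0 \<le> u" "u \<le> t" for u
    proof -
      have "cos t \<le> cos u" using that t by (intro cos_monotone_0_pi_le) auto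
      then have "K t \<le> K u" using e2 by (simp add: K_def)
      then show ?thesis using 3 by simp
    qed
    define W where "W u = 2/3 * (sin u * (2 + e * cos u)) / ((1 + e * cos u) * K u) - ktime e u" for u
    define W' where "W' u = (1 - e\<^sup>2) * (2 + 2 * e * cos u - e * cos u^3 - (3/2 - e\<^sup>2/2) * (cos u)\<^sup>2)
        * (2/3) / ((1 + e * cos u) * K u)\<^sup>2" for u
    have "W 0 < W t"
    proof (rule DERIV_within_pos_imp_less[where a = 0 and b = t and f = W and f' = W'])
      show "(W has_real_derivative W' u) (at u within {0..t})" if u: "u \<in> {0..t}" for u
      proof -
        have fu: "1 + e * cos u \<noteq> 0" using f[of u] by simp
        have Kn: "K u \<noteq> 0" using Ku[of u] u by simp
        have dN: "((\<lambda>u. 2/3 * (sin u * (2 + e * cos u))) has_real_derivative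
            2/3 * (2 * cos u + 2 * e * (cos u)\<^sup>2 - e)) (at u within {0..t})"
        proof (rule DERIV_cmult)
          show "((\<lambda>u. sin u * (2 + e * cos u)) has_real_derivative 2 * cos u + 2 * e * (cos u)\<^sup>2 - e) (at u within {0..t})"
            by (auto intro!: derivative_eq_intros simp: algebra_simps power2_eq_square sin_sq[of u])
        qed
        have dM: "((\<lambda>u. (1 + e * cos u) * K u) has_real_derivative
            - sin u * (e * K u + (1 + e * cos u) * (1 + e\<^sup>2))) (at u within {0..t})"
          unfolding K_def by (auto intro!: derivative_eq_intros simp: algebra_simps)
        have dT: "(ktime e has_real_derivative 1 / (1 + e * cos u)\<^sup>2) (at u within {0..t})"
          by (rule DERIV_subset[OF ktime_deriv[OF e]]) (use u t in auto)
        have M0: "(1 + e * cos u) * K u \<noteq> 0" using fu Kn by simp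
        \<comment> \<open>The numerator of the derivative of \<open>W\<close> over the common
          denominator.\<close>
        have id: "2/3 * (2 * cos u + 2 * e * (cos u)\<^sup>2 - e) * ((1 + e * cos u) * K u)
            - 2/3 * (sin u * (2 + e * cos u)) * (- sin u * (e * K u + (1 + e * cos u) * (1 + e\<^sup>2))) - (K u)\<^sup>2
          = (1 - e\<^sup>2) * (2 + 2 * e * cos u - e * cos u^3 - (3/2 - e\<^sup>2/2) * (cos u)\<^sup>2) * (2/3)"
          using sin_squared_eq[of u] unfolding K_def by algebra
        have "1 / (1 + e * cos u)\<^sup>2 = (K u)\<^sup>2 / ((1 + e * cos u) * K u)\<^sup>2"
          using fu Kn by (simp add: power_mult_distrib)
        then have "(2/3 * (2 * cos u + 2 * e * (cos u)\<^sup>2 - e) * ((1 + e * cos u) * K u)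
            - 2/3 * (sin u * (2 + e * cos u)) * (- sin u * (e * K u + (1 + e * cos u) * (1 + e\<^sup>2))))
              / (((1 + e * cos u) * K u) * ((1 + e * cos u) * K u)) - 1 / (1 + e * cos u)\<^sup>2 = W' u"
          unfolding W'_def id[symmetric] by (simp add: diff_divide_distrib power2_eq_square)
        then show ?thesis
          using DERIV_diff[OF DERIV_divide[OF dN dM M0] dT] unfolding W_def[abs_def] by simp
      qed
      show "0 < W' u" if u: "u \<in> {0<..<t}" for u
      proof -
        have "cos u \<noteq> -1"
        proof
          assume "cos u = -1"
          then have "K u = - (1 - e)\<^sup>2" by (simp add: K_def power2_eq_square algebra_simps)
          then show False using Ku[of u] u by simp
        qed
        then have "-1 < cos u" using cos_ge_minus_one[of u] by linarith
        then have "0 < 2 + 2 * e * cos u - e * cos u^3 - (3/2 - e\<^sup>2/2) * (cos u)\<^sup>2"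
          using kdet_poly_pos[OF e] by simp
        moreover have "0 < 1 - e\<^sup>2" using e by (simp add: power_less_one_iff abs_square_less_1)
        moreover have "0 < ((1 + e * cos u) * K u)\<^sup>2" using f[of u] Ku[of u] u by simp
        ultimately show ?thesis unfolding W'_def by (intro divide_pos_pos mult_pos_pos) auto
      qed
    qed (use t in auto)
    then have "ktime e t < 2/3 * (sin t * (2 + e * cos t)) / ((1 + e * cos t) * K t)"
      by (simp add: W_def)
    moreover have "0 < (1 + e * cos t) * K t" using f 3 by simp
    ultimately have "ktime e t * ((1 + e * cos t) * K t) < 2/3 * (sin t * (2 + e * cos t))"
      by (simp add: pos_less_divide_eq)
    then show ?thesis unfolding kd by simp
  qed
qed

section \<open>Picone identities\<close>

lemma DERIV_within_at:
  assumes "(f has_real_derivative D) (at t within {a..b})" "a < t" "t < b"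
  shows "(f has_real_derivative D) (at t)"
proof -
  have "t \<in> interior {a..b}" using assms by simp
  then show ?thesis using assms(1) at_within_interior[of t "{a..b}"] by simp
qed

text \<open>The letters \<open>a\<close> and \<open>d\<close> form a frame of two Kepler-type
  solutions with conserved momenta \<open>e\<close> and \<open>g\<close>; \<open>c1\<close>,
  \<open>c2\<close> are the coordinates of the positions in it, and \<open>w1\<close>,
  \<open>w2\<close> the velocity and momentum obtained by freezing these coordinates. Thus
  \<open>v - w1\<close> and \<open>y - w2\<close> contain only the derivatives of \<open>c1\<close>,
  \<open>c2\<close>, and the cross terms cancel because the frame is isotropic, by
  \<open>iso\<close>.\<close>

lemma picone_quotient:
  fixes a1 a2 aa1 d1 d2 dd1 c1 c2 q1 q2 :: "real \<Rightarrow> real"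
  assumes S: "open S" "t \<in> S"
    and q: "\<And>u. u \<in> S \<Longrightarrow> q1 u = a1 u * c1 u + d1 u * c2 u"
      "\<And>u. u \<in> S \<Longrightarrow> q2 u = a2 u * c1 u + d2 u * c2 u"
    and c: "(c1 has_real_derivative c1') (at t)" "(c2 has_real_derivative c2') (at t)"
    and a: "(a1 has_real_derivative aa1 t) (at t)" "(a2 has_real_derivative e - 2 * a1 t) (at t)"
      "(aa1 has_real_derivative k * a1 t + 2 * e) (at t)"
    and d: "(d1 has_real_derivative dd1 t) (at t)" "(d2 has_real_derivative g - 2 * d1 t) (at t)"
      "(dd1 has_real_derivative k * d1 t + 2 * g) (at t)"
    and iso: "a1 t * dd1 t - aa1 t * d1 t + a2 t * g - e * d2 t = 0"
    and dq: "(q1 has_real_derivative v) (at t)" "(q2 has_real_derivative y - 2 * q1 t) (at t)"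
  defines "w1 \<equiv> \<lambda>u. aa1 u * c1 u + dd1 u * c2 u" and "w2 \<equiv> \<lambda>u. e * c1 u + g * c2 u"
  shows "((\<lambda>u. q1 u * w1 u + q2 u * w2 u) has_real_derivative
    v\<^sup>2 + y\<^sup>2 + k * (q1 t)\<^sup>2 - ((v - w1 t)\<^sup>2 + (y - w2 t)\<^sup>2)) (at t)"
proof -
  have "(q1 has_real_derivative (aa1 t * c1 t + c1' * a1 t) + (dd1 t * c2 t + c2' * d1 t)) (at t)"
    by (rule has_field_derivative_transform_within_open[OF DERIV_add[OF DERIV_mult[OF a(1) c(1)] DERIV_mult[OF d(1) c(2)]] S])
      (simp add: q)
  then have v: "v = (aa1 t * c1 t + c1' * a1 t) + (dd1 t * c2 t + c2' * d1 t)"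
    using dq(1) DERIV_unique by blast
  have "(q2 has_real_derivative ((e - 2 * a1 t) * c1 t + c1' * a2 t) + ((g - 2 * d1 t) * c2 t + c2' * d2 t)) (at t)"
    by (rule has_field_derivative_transform_within_open[OF DERIV_add[OF DERIV_mult[OF a(2) c(1)] DERIV_mult[OF d(2) c(2)]] S])
      (simp add: q)
  then have "y - 2 * q1 t = ((e - 2 * a1 t) * c1 t + c1' * a2 t) + ((g - 2 * d1 t) * c2 t + c2' * d2 t)"
    using dq(2) DERIV_unique by blast
  then have y: "y = e * c1 t + c1' * a2 t + (g * c2 t + c2' * d2 t)"
    using q(1)[OF S(2)] by (simp add: algebra_simps)
  have w1: "(w1 has_real_derivative ((k * a1 t + 2 * e) * c1 t + c1' * aa1 t) + ((k * d1 t + 2 * g) * c2 t + c2' * dd1 t)) (at t)"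
    unfolding w1_def by (intro DERIV_add DERIV_mult a c d)
  have w2: "(w2 has_real_derivative e * c1' + g * c2') (at t)"
    unfolding w2_def by (intro DERIV_add DERIV_cmult c)
  have "v * w1 t + ((k * a1 t + 2 * e) * c1 t + c1' * aa1 t + ((k * d1 t + 2 * g) * c2 t + c2' * dd1 t)) * q1 t
      + ((y - 2 * q1 t) * w2 t + (e * c1' + g * c2') * q2 t)
    = v\<^sup>2 + y\<^sup>2 + k * (q1 t)\<^sup>2 - ((v - w1 t)\<^sup>2 + (y - w2 t)\<^sup>2)"
    unfolding v y w1_def w2_def q(1)[OF S(2)] q(2)[OF S(2)] using iso by algebra
  then show ?thesis
    using DERIV_add[OF DERIV_mult[OF dq(1) w1] DERIV_mult[OF dq(2) w2]] by simp
qed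

text \<open>Velocity \<open>q1'\<close> and momentum \<open>q2' + 2 q1\<close>, in the gauge in which the Lagrangian at \<open>\<beta> = 0\<close> is
  \<open>q1'\<^sup>2 + (q2' + 2 q1)\<^sup>2 + kpot q1\<^sup>2\<close>.\<close>

definition sol_v :: "(real \<Rightarrow> real^4) \<Rightarrow> real \<Rightarrow> real" where "sol_v x t = x t $ 1 + x t $ 4"
definition sol_y :: "(real \<Rightarrow> real^4) \<Rightarrow> real \<Rightarrow> real" where "sol_y x t = x t $ 2 + x t $ 3"

lemma solves_lagrangian:
  assumes x: "solves \<beta> e x" and t: "t \<in> {0..2*pi}"
  shows "((\<lambda>t. x t $ 3) has_real_derivative sol_v x t) (at t within {0..2*pi})"
    "((\<lambda>t. x t $ 4) has_real_derivative sol_y x t - 2 * x t $ 3) (at t within {0..2*pi})"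
    "(sol_v x has_real_derivative 2 * sol_y x t - (3 + coeff1 \<beta> e t) * x t $ 3) (at t within {0..2*pi})"
    "(sol_y x has_real_derivative (1 - coeff2 \<beta> e t) * x t $ 4) (at t within {0..2*pi})"
proof -
  note c = solves_component[OF x t]
  show "((\<lambda>t. x t $ 3) has_real_derivative sol_v x t) (at t within {0..2*pi})"
    using c(3) by (simp add: sol_v_def)
  show "((\<lambda>t. x t $ 4) has_real_derivative sol_y x t - 2 * x t $ 3) (at t within {0..2*pi})"
    using c(4) by (simp add: sol_y_def)
  show "(sol_v x has_real_derivative 2 * sol_y x t - (3 + coeff1 \<beta> e t) * x t $ 3) (at t within {0..2*pi})"
    using DERIV_add[OF c(1) c(4)] by (simp add: sol_v_def[abs_def] sol_y_def algebra_simps)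
  show "(sol_y x has_real_derivative (1 - coeff2 \<beta> e t) * x t $ 4) (at t within {0..2*pi})"
    using DERIV_add[OF c(2) c(3)] by (simp add: sol_y_def[abs_def] algebra_simps)
qed

lemma solves_zero: "solves \<beta> e (\<lambda>t. 0)"
  by (simp add: solves_def)

text \<open>The action splits with weights \<open>r = sqrt (9 - \<beta>) / 3\<close> at \<open>\<beta> = 0\<close> and \<open>1 - r\<close> at \<open>\<beta> = 9\<close>. The hypothesis on \<open>F\<close>
  disposes of the first part, and the second is made a sum of squares by the supersolution \<open>1 + e cos t\<close>.\<close>

lemma picone_implies_zero:
  fixes F P :: "real \<Rightarrow> real"
  assumes e: "0 \<le> e" "e < 1" and \<beta>: "0 < \<beta>" "\<beta> \<le> 9" and x: "solves \<beta> e x"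
    and dF: "\<And>t. 0 < t \<Longrightarrow> t < pi \<Longrightarrow> (F has_real_derivative
        (sol_v x t)\<^sup>2 + (sol_y x t)\<^sup>2 + kpot e t * (x t $ 3)\<^sup>2 - P t) (at t)"
    and P: "\<And>t. 0 < t \<Longrightarrow> t < pi \<Longrightarrow> 0 \<le> P t"
    and lim: "(F \<longlongrightarrow> 0) (at_right 0)" "(F \<longlongrightarrow> 0) (at_left pi)"
    and bc: "\<And>t. t \<in> {0, pi} \<Longrightarrow> x t $ 3 * sol_v x t + x t $ 4 * sol_y x t = 0 \<and> x t $ 3 * x t $ 4 = 0"
    and t: "t \<in> {0..2*pi}"
  shows "x t = 0"
proof -
  define r where "r = sqrt (9 - \<beta>) / 3"
  have "sqrt (9 - \<beta>) < sqrt 9" using \<beta> by (intro real_sqrt_less_mono) simp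
  then have r: "0 \<le> r" "r < 1" using \<beta> by (auto simp: r_def)
  have f: "0 < 1 + e * cos u" for u by (rule ecc_pos[OF e])
  define Q where "Q u = (x u $ 3)\<^sup>2 + (x u $ 4)\<^sup>2" for u
  define g where "g u = - e * sin u / (1 + e * cos u)" for u
  \<comment> \<open>The boundary term of the action. For \<open>r = 1\<close> it is position times
    \<open>(sol_v, sol_y)\<close>; for \<open>r = 0\<close> it is position times the momenta
    \<open>(x $ 1, x $ 2)\<close>, corrected by \<open>Q * g\<close>.\<close>
  define R where "R u = x u $ 3 * sol_v x u + x u $ 4 * sol_y x u - (1 - r) * (Q u * g u + 2 * (x u $ 3 * x u $ 4))" for u
  \<comment> \<open>\<open>sol_v - x $ 4\<close> and \<open>sol_y - x $ 3\<close> are the momenta,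
    that is, the velocity in non-rotating coordinates. With \<open>w = 1 + e cos u\<close> one has
    \<open>g = w' / w\<close>; the squares complete the Hill action, and the last term is the excess
    \<open>1 / (2 w)\<close> of its potential over \<open>w'' / w\<close>.\<close>
  define Z where "Z u = (sol_v x u - x u $ 4 - x u $ 3 * g u)\<^sup>2 + (sol_y x u - x u $ 3 - x u $ 4 * g u)\<^sup>2
     + Q u / (2 * (1 + e * cos u))" for u
  have dR: "(R has_real_derivative (1 - r) * Z u
      + r * ((sol_v x u)\<^sup>2 + (sol_y x u)\<^sup>2 + kpot e u * (x u $ 3)\<^sup>2)) (at u within {0..2*pi})"
    if u: "u \<in> {0..2*pi}" for u
  proof -
    note L = solves_lagrangian[OF x u]
    have fu: "1 + e * cos u \<noteq> 0" using f[of u] by simp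
    define h where "h = 1 / (1 + e * cos u)"
    have hf: "h * (1 + e * cos u) = 1" using fu by (simp add: h_def)
    have gh: "g u = - e * sin u * h" by (simp add: g_def h_def)
    \<comment> \<open>The Riccati equation of \<open>g = w' / w\<close>, where
      \<open>w'' / w = h - 1\<close>.\<close>
    have dg: "(g has_real_derivative (h - 1) - (g u)\<^sup>2) (at u within {0..2*pi})"
    proof -
      have "(g has_real_derivative ((- e * cos u) * (1 + e * cos u) - (- e * sin u) * (- e * sin u))
          / ((1 + e * cos u) * (1 + e * cos u))) (at u within {0..2*pi})"
        unfolding g_def[abs_def] using fu
        by (intro DERIV_divide) (auto intro!: derivative_eq_intros)
      moreover have "((- e * cos u) * (1 + e * cos u) - (- e * sin u) * (- e * sin u))
          / ((1 + e * cos u) * (1 + e * cos u)) = (h - 1) - (g u)\<^sup>2"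
      proof -
        have "((- e * cos u) * (1 + e * cos u) - (- e * sin u) * (- e * sin u)) * h * h
            = (h - 1) - (- e * sin u * h)\<^sup>2" using hf by algebra
        then show ?thesis unfolding gh by (simp add: h_def)
      qed
      ultimately show ?thesis by simp
    qed
    have dQ: "(Q has_real_derivative 2 * x u $ 3 * sol_v x u + 2 * x u $ 4 * (sol_y x u - 2 * x u $ 3)) (at u within {0..2*pi})"
      unfolding Q_def[abs_def] using DERIV_add[OF DERIV_power[OF L(1), of 2] DERIV_power[OF L(2), of 2]]
      by (simp add: algebra_simps)
    note D = DERIV_diff[OF DERIV_add[OF DERIV_mult[OF L(1) L(3)] DERIV_mult[OF L(2) L(4)]]
        DERIV_cmult[OF DERIV_add[OF DERIV_mult[OF dQ dg] DERIV_cmult[OF DERIV_mult[OF L(1) L(2)], of 2]], of "1 - r"]]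
    have c1: "3 + coeff1 \<beta> e u = 4 - 3 * (1 + r) * h / 2"
      using fu by (simp add: coeff1_def r_def h_def field_simps)
    have c2: "1 - coeff2 \<beta> e u = 3 * (1 - r) * h / 2"
      using fu by (simp add: coeff2_def r_def h_def field_simps)
    have k: "kpot e u = 3 * h - 4" by (simp add: kpot_def h_def)
    have qh: "Q u / (2 * (1 + e * cos u)) = Q u * h / 2" by (simp add: h_def)
    show ?thesis
      unfolding R_def[abs_def]
      by (rule DERIV_cong[OF D], unfold c1 c2 k Z_def, unfold qh, unfold Q_def) (simp add: field_simps power2_eq_square)
  qed
  \<comment> \<open>Subtracting \<open>r * F\<close> trades the Kepler share of the action for
    \<open>r * P\<close>. The difference is nondecreasing with vanishing limits, so its derivative
    is zero.\<close>
  have "(1 - r) * Z u + r * P u = 0" if u: "0 < u" "u < pi" for u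
  proof (rule DERIV_zero_of_vanishing_ends[where G = "\<lambda>u. R u - r * F u"
        and G' = "\<lambda>u. (1 - r) * Z u + r * P u" and a = 0 and b = pi])
    show "((\<lambda>u. R u - r * F u) has_real_derivative (1 - r) * Z u + r * P u) (at u)" if u: "0 < u" "u < pi" for u
    proof -
      have "(R has_real_derivative (1 - r) * Z u + r * ((sol_v x u)\<^sup>2 + (sol_y x u)\<^sup>2 + kpot e u * (x u $ 3)\<^sup>2)) (at u)"
        by (rule DERIV_within_at[OF dR]) (use u in auto)
      from DERIV_diff[OF this DERIV_cmult[OF dF[OF u], of r]] show ?thesis
        by (simp add: algebra_simps)
    qed
    show "0 \<le> (1 - r) * Z u + r * P u" if "0 < u" "u < pi" for u
      using r P[OF that] f[of u] by (auto simp: Z_def Q_def intro!: add_nonneg_nonneg mult_nonneg_nonneg divide_nonneg_pos)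
    have cR: "(R \<longlongrightarrow> R t) (at t within {0..2*pi})" if "t \<in> {0..2*pi}" for t
      using DERIV_continuous[OF dR[OF that]] by (simp add: continuous_within)
    have g0: "g 0 = 0" "g pi = 0" by (simp_all add: g_def)
    have R0: "R 0 = 0" "R pi = 0" using bc[of 0] bc[of pi] g0 by (auto simp: R_def)
    have "(R \<longlongrightarrow> 0) (at_right 0)"
      using cR[of 0] R0 at_within_Icc_at_right[of 0 "2*pi"] by simp
    from tendsto_diff[OF this tendsto_mult_left[OF lim(1), of r]]
    show "((\<lambda>u. R u - r * F u) \<longlongrightarrow> 0) (at_right 0)" by simp
    have "(R \<longlongrightarrow> 0) (at pi)"
      using cR[of pi] R0 at_within_interior[of pi "{0..2*pi}"] by simp
    then have "(R \<longlongrightarrow> 0) (at_left pi)" by (rule tendsto_within_subset) simp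
    from tendsto_diff[OF this tendsto_mult_left[OF lim(2), of r]]
    show "((\<lambda>u. R u - r * F u) \<longlongrightarrow> 0) (at_left pi)" by simp
  qed (use u in auto)
  \<comment> \<open>Positivity of \<open>\<beta>\<close> makes \<open>r < 1\<close>, so
    \<open>Z\<close> vanishes on its own, and its last term gives \<open>Q = 0\<close>.\<close>
  then have Q0: "Q u = 0" if u: "0 < u" "u < pi" for u
  proof -
    have "0 \<le> r * P u" using r P[OF u] by simp
    moreover have "(1 - r) * Z u + r * P u = 0" using u \<open>\<And>u. 0 < u \<Longrightarrow> u < pi \<Longrightarrow> (1 - r) * Z u + r * P u = 0\<close> by blast
    ultimately have "(1 - r) * Z u \<le> 0" by linarith
    then have "Z u \<le> 0" using r by (simp add: mult_le_0_iff)
    moreover have "Q u / (2 * (1 + e * cos u)) \<le> Z u" by (simp add: Z_def)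
    ultimately have "Q u / (2 * (1 + e * cos u)) \<le> 0" by linarith
    then have "Q u \<le> 0" using f[of u] by (simp add: divide_le_0_iff)
    moreover have "0 \<le> Q u" by (simp add: Q_def)
    ultimately show ?thesis by simp
  qed
  then have q0: "x u $ 3 = 0" "x u $ 4 = 0" if "0 < u" "u < pi" for u
    using that Q0[OF that] by (auto simp: Q_def sum_power2_eq_zero_iff)
  \<comment> \<open>The positions vanish on an open interval, so the velocities vanish at its
    interior point \<open>pi / 2\<close> too, and uniqueness applies from there.\<close>
  have m: "pi / 2 \<in> {0..2*pi}" "0 < pi/2" "pi/2 < pi" using pi_gt_zero by auto
  have z: "((\<lambda>u. 0::real) has_real_derivative D) (at (pi/2)) \<Longrightarrow> D = 0" for D
    using DERIV_unique DERIV_const by blast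
  have "((\<lambda>u. x u $ 3) has_real_derivative sol_v x (pi/2)) (at (pi/2))"
    "((\<lambda>u. x u $ 4) has_real_derivative sol_y x (pi/2) - 2 * x (pi/2) $ 3) (at (pi/2))"
    using solves_lagrangian(1,2)[OF x m(1)] m by (auto intro!: DERIV_within_at[of _ _ _ 0 "2*pi"])
  then have "((\<lambda>u. 0) has_real_derivative sol_v x (pi/2)) (at (pi/2))"
    "((\<lambda>u. 0) has_real_derivative sol_y x (pi/2) - 2 * x (pi/2) $ 3) (at (pi/2))"
    by (auto elim!: has_field_derivative_transform_within_open[where S = "{0<..<pi}"] simp: q0)
  then have "sol_v x (pi/2) = 0" "sol_y x (pi/2) - 2 * x (pi/2) $ 3 = 0" using z by blast+
  then have "x (pi/2) = 0" using q0[of "pi/2"] m by (simp add: vec_eq_iff forall_4 sol_v_def sol_y_def)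
  then show ?thesis using solves_unique[OF e x solves_zero m(1) _ t] by simp
qed

lemma at_left_pi_tendsto:
  assumes "(f has_real_derivative D) (at pi within {0..2*pi})"
  shows "(f \<longlongrightarrow> f pi) (at_left pi)"
proof -
  have "(f has_real_derivative D) (at pi)" by (rule DERIV_within_at[OF assms]) auto
  then have "isCont f pi" by (rule DERIV_isCont)
  then have "(f \<longlongrightarrow> f pi) (at pi)" by (simp add: isCont_def)
  then show ?thesis by (rule tendsto_within_subset) simp
qed

text \<open>In this class a one-dimensional Picone identity suffices: the square of
  \<open>sol_y\<close> is kept as it stands. Up to a constant, \<open>h\<close> is the factor of
  \<open>ktime\<close> in \<open>scal_q1\<close>, which reflects a shift of time along the orbit; it
  solves \<open>h'' = kpot h\<close>, is positive inside and has simple zeros at both ends, where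
  \<open>q1\<close> vanishes as well.\<close>

lemma odd_solution_zero:
  assumes e: "0 \<le> e" "e < 1" and \<beta>: "0 < \<beta>" "\<beta> \<le> 9" and x: "solves \<beta> e x"
    and bc: "\<And>t. t \<in> {0, pi} \<Longrightarrow> x t $ 3 = 0 \<and> x t $ 2 = 0" and t: "t \<in> {0..2*pi}"
  shows "x t = 0"
proof -
  define h where "h t = (1 + e * cos t) * sin t" for t
  define hh where "hh t = (1 + e * cos t) * cos t - e * (sin t)\<^sup>2" for t
  have f: "0 < 1 + e * cos u" for u by (rule ecc_pos[OF e])
  have dh: "(h has_real_derivative hh u) (at u within S)" for u S
    unfolding h_def[abs_def] hh_def by (auto intro!: derivative_eq_intros simp: power2_eq_square)
  have dhh: "(hh has_real_derivative kpot e u * h u) (at u within S)" for u S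
  proof -
    have "kpot e u * h u = - sin u * (1 + 4 * e * cos u)"
      using f[of u] unfolding kpot_def h_def
      by (simp add: left_diff_distrib less_imp_neq) (simp add: algebra_simps)
    then show ?thesis
      unfolding hh_def[abs_def] by (auto intro!: derivative_eq_intros simp: algebra_simps)
  qed
  have hpos: "0 < h u" if "0 < u" "u < pi" for u using that f[of u] sin_gt_zero[of u] by (simp add: h_def)
  define F where "F t = ((x t $ 3)\<^sup>2 * hh t) / h t" for t
  define P where "P t = (sol_v x t - x t $ 3 * (hh t / h t))\<^sup>2 + (sol_y x t)\<^sup>2" for t
  have dn: "((\<lambda>t. (x t $ 3)\<^sup>2 * hh t) has_real_derivative
      2 * x u $ 3 * sol_v x u * hh u + kpot e u * h u * (x u $ 3)\<^sup>2) (at u within {0..2*pi})"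
    if u: "u \<in> {0..2*pi}" for u
    using DERIV_mult[OF DERIV_power[OF solves_lagrangian(1)[OF x u], of 2] dhh] by (simp add: mult_ac)
  show ?thesis
  proof (rule picone_implies_zero[OF e \<beta> x _ _ _ _ _ t, where F = F and P = P])
    fix u :: real assume u: "0 < u" "u < pi"
    have h0: "h u \<noteq> 0" using hpos[OF u] by simp
    have "((\<lambda>t. (x t $ 3)\<^sup>2 * hh t) has_real_derivative
        2 * x u $ 3 * sol_v x u * hh u + kpot e u * h u * (x u $ 3)\<^sup>2) (at u)"
      by (rule DERIV_within_at[OF dn]) (use u in auto)
    note D = DERIV_divide[OF this dh h0]
    show "(F has_real_derivative (sol_v x u)\<^sup>2 + (sol_y x u)\<^sup>2 + kpot e u * (x u $ 3)\<^sup>2 - P u) (at u)"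
      unfolding F_def[abs_def] P_def using h0
      by (intro DERIV_cong[OF D]) (simp add: field_simps power2_eq_square)
    show "0 \<le> P u" by (simp add: P_def)
  next
    show "(F \<longlongrightarrow> 0) (at_right 0)"
      unfolding F_def
    proof (rule quotient_tendsto_0_right)
      show "((\<lambda>t. (x t $ 3)\<^sup>2 * hh t) has_real_derivative 0) (at 0 within {0..2*pi})"
        using dn[of 0] bc[of 0] by simp
      show "(h has_real_derivative 1 + e) (at 0 within {0..2*pi})"
        using dh[of 0] by (simp add: hh_def)
    qed (use bc[of 0] e in \<open>auto simp: h_def\<close>)
    show "(F \<longlongrightarrow> 0) (at_left pi)"
      unfolding F_def
    proof (rule quotient_tendsto_0_left)
      have "((\<lambda>t. (x t $ 3)\<^sup>2 * hh t) has_real_derivative 0) (at pi within {0..2*pi})"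
        using dn[of pi] bc[of pi] by simp
      then show "((\<lambda>t. (x t $ 3)\<^sup>2 * hh t) has_real_derivative 0) (at pi within {0..pi})"
        by (rule DERIV_subset) auto
      show "(h has_real_derivative - (1 - e)) (at pi within {0..pi})"
        using dh[of pi] by (simp add: hh_def)
    qed (use bc[of pi] e in \<open>auto simp: h_def\<close>)
  next
    fix u :: real assume "u \<in> {0, pi}"
    from bc[OF this] show "x u $ 3 * sol_v x u + x u $ 4 * sol_y x u = 0 \<and> x u $ 3 * x u $ 4 = 0"
      by (simp add: sol_y_def)
  qed
qed

text \<open>Here both positions enter, and the Picone identity is taken in the frame of the two
  Kepler solutions, which satisfy the same boundary condition at 0. Positivity of
  \<open>kdet\<close> up to and including \<open>pi\<close> keeps the frame nondegenerate.\<close>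

lemma even_solution_zero:
  assumes e: "0 \<le> e" "e < 1" and \<beta>: "0 < \<beta>" "\<beta> \<le> 9" and x: "solves \<beta> e x"
    and bc: "\<And>t. t \<in> {0, pi} \<Longrightarrow> x t $ 1 = 0 \<and> x t $ 4 = 0" and t: "t \<in> {0..2*pi}"
  shows "x t = 0"
proof -
  \<comment> \<open>By Cramer's rule, \<open>N1 / kdet\<close> and \<open>N2 / kdet\<close> are the
    coordinates of the positions in the frame. The boundary term is \<open>n / kdet\<close> with a
    single division, which makes its limit at 0 accessible.\<close>
  define N1 where "N1 t = x t $ 3 * scal_q2 e t - x t $ 4 * scal_q1 e t" for t
  define N2 where "N2 t = ecc_q1 e t * x t $ 4 - ecc_q2 e t * x t $ 3" for t
  define n where "n t = x t $ 3 * (ecc_q1_deriv e t * N1 t + scal_q1_deriv e t * N2 t) + x t $ 4 * (e * N1 t + 1/2 * N2 t)" for t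
  define c1 where "c1 t = N1 t / kdet e t" for t
  define c2 where "c2 t = N2 t / kdet e t" for t
  define F where "F t = n t / kdet e t" for t
  define P where "P t = (sol_v x t - (ecc_q1_deriv e t * c1 t + scal_q1_deriv e t * c2 t))\<^sup>2 + (sol_y x t - (e * c1 t + 1/2 * c2 t))\<^sup>2" for t
  have F_eq: "F = (\<lambda>t. x t $ 3 * (ecc_q1_deriv e t * c1 t + scal_q1_deriv e t * c2 t) + x t $ 4 * (e * c1 t + 1/2 * c2 t))"
    by (rule ext) (simp add: F_def n_def c1_def c2_def add_divide_distrib algebra_simps)
  note kd = kepler_derivs[OF e] and L = solves_lagrangian[OF x]
  have dN1: "(N1 has_real_derivative sol_v x u * scal_q2 e u + (1/2 - 2 * scal_q1 e u) * x u $ 3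
        - ((sol_y x u - 2 * x u $ 3) * scal_q1 e u + scal_q1_deriv e u * x u $ 4)) (at u within {0..2*pi})"
    if "u \<in> {0..2*pi}" for u unfolding N1_def[abs_def] by (intro DERIV_diff DERIV_mult kd L that)
  have dN2: "(N2 has_real_derivative ecc_q1_deriv e u * x u $ 4 + (sol_y x u - 2 * x u $ 3) * ecc_q1 e u
        - ((e - 2 * ecc_q1 e u) * x u $ 3 + sol_v x u * ecc_q2 e u)) (at u within {0..2*pi})"
    if "u \<in> {0..2*pi}" for u unfolding N2_def[abs_def] by (intro DERIV_diff DERIV_mult kd L that)
  have dk: "(kdet e has_real_derivative ecc_q1_deriv e u * scal_q2 e u + (1/2 - 2 * scal_q1 e u) * ecc_q1 e u
        - ((e - 2 * ecc_q1 e u) * scal_q1 e u + scal_q1_deriv e u * ecc_q2 e u)) (at u within {0..2*pi})"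
    if "u \<in> {0..2*pi}" for u unfolding kdet_def[abs_def] by (intro DERIV_diff DERIV_mult kd that)
  have dn: "(n has_real_derivative
      (sol_v x u * (ecc_q1_deriv e u * N1 u + scal_q1_deriv e u * N2 u) + (((kpot e u * ecc_q1 e u + 2 * e) * N1 u + N1' * ecc_q1_deriv e u)
         + ((kpot e u * scal_q1 e u + 1) * N2 u + N2' * scal_q1_deriv e u)) * x u $ 3)
      + ((sol_y x u - 2 * x u $ 3) * (e * N1 u + 1/2 * N2 u) + (e * N1' + 1/2 * N2') * x u $ 4)) (at u within {0..2*pi})"
    if "u \<in> {0..2*pi}" "(N1 has_real_derivative N1') (at u within {0..2*pi})"
      "(N2 has_real_derivative N2') (at u within {0..2*pi})" for u N1' N2'
    unfolding n_def[abs_def] by (intro DERIV_add DERIV_mult DERIV_cmult kd L that)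
  have ends: "N1 0 = 0" "N2 0 = 0" "N2 pi = 0" "ecc_q1_deriv e 0 = 0" "scal_q1_deriv e 0 = 0" "ecc_q1_deriv e pi = 0"
    using bc[of 0] bc[of pi] by (simp_all add: N1_def N2_def scal_q2_def ecc_q2_def ecc_q1_deriv_def scal_q1_deriv_def)
  show ?thesis
  proof (rule picone_implies_zero[OF e \<beta> x _ _ _ _ _ t, where F = F and P = P])
    fix u :: real assume u: "0 < u" "u < pi"
    have uI: "u \<in> {0..2*pi}" using u by auto
    have k0: "kdet e w \<noteq> 0" if "w \<in> {0<..<pi}" for w using kdet_pos[OF e, of w] that by auto
    have k0u: "kdet e u \<noteq> 0" using k0 u by simp
    have at: "(f has_real_derivative D) (at u)" if "(f has_real_derivative D) (at u within {0..2*pi})" for f D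
      by (rule DERIV_within_at[OF that]) (use u in auto)
    show "(F has_real_derivative (sol_v x u)\<^sup>2 + (sol_y x u)\<^sup>2 + kpot e u * (x u $ 3)\<^sup>2 - P u) (at u)"
      unfolding F_eq P_def
    proof (rule picone_quotient[where ?a1.0 = "ecc_q1 e" and ?a2.0 = "ecc_q2 e" and ?d1.0 = "scal_q1 e" and ?d2.0 = "scal_q2 e"])
      show "open {0<..<pi}" "u \<in> {0<..<pi}" using u by auto
      show "x w $ 3 = ecc_q1 e w * c1 w + scal_q1 e w * c2 w" if "w \<in> {0<..<pi}" for w
        using k0[OF that] unfolding c1_def c2_def N1_def N2_def
        by (simp add: add_divide_distrib[symmetric] nonzero_eq_divide_eq) (simp add: kdet_def algebra_simps)
      show "x w $ 4 = ecc_q2 e w * c1 w + scal_q2 e w * c2 w" if "w \<in> {0<..<pi}" for w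
        using k0[OF that] unfolding c1_def c2_def N1_def N2_def
        by (simp add: add_divide_distrib[symmetric] nonzero_eq_divide_eq) (simp add: kdet_def algebra_simps)
      show "(c1 has_real_derivative ((sol_v x u * scal_q2 e u + (1/2 - 2 * scal_q1 e u) * x u $ 3
        - ((sol_y x u - 2 * x u $ 3) * scal_q1 e u + scal_q1_deriv e u * x u $ 4)) * kdet e u
          - N1 u * (ecc_q1_deriv e u * scal_q2 e u + (1/2 - 2 * scal_q1 e u) * ecc_q1 e u
        - ((e - 2 * ecc_q1 e u) * scal_q1 e u + scal_q1_deriv e u * ecc_q2 e u))) / (kdet e u * kdet e u)) (at u)"
        unfolding c1_def[abs_def] by (intro DERIV_divide at dN1 dk uI k0u)
      show "(c2 has_real_derivative ((ecc_q1_deriv e u * x u $ 4 + (sol_y x u - 2 * x u $ 3) * ecc_q1 e u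
        - ((e - 2 * ecc_q1 e u) * x u $ 3 + sol_v x u * ecc_q2 e u)) * kdet e u
          - N2 u * (ecc_q1_deriv e u * scal_q2 e u + (1/2 - 2 * scal_q1 e u) * ecc_q1 e u
        - ((e - 2 * ecc_q1 e u) * scal_q1 e u + scal_q1_deriv e u * ecc_q2 e u))) / (kdet e u * kdet e u)) (at u)"
        unfolding c2_def[abs_def] by (intro DERIV_divide at dN2 dk uI k0u)
      show "(scal_q1_deriv e has_real_derivative kpot e u * scal_q1 e u + 2 * (1/2)) (at u)" using at[OF kd(6)[OF uI]] by simp
      show "ecc_q1 e u * scal_q1_deriv e u - ecc_q1_deriv e u * scal_q1 e u + ecc_q2 e u * (1/2) - e * scal_q2 e u = 0"
        using kepler_isotropic[OF e, of u] by simp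
    qed (intro at kd L uI)+
    show "0 \<le> P u" by (simp add: P_def)
  next
    show "(F \<longlongrightarrow> 0) (at_right 0)"
      unfolding F_def
    proof (rule quotient_tendsto_0_right)
      show "(n has_real_derivative 0) (at 0 within {0..2*pi})"
        using dn[OF _ dN1 dN2, of 0] ends bc[of 0] by simp
      \<comment> \<open>The zero of \<open>kdet\<close> at 0 is simple because \<open>e < 1\<close>,
        whereas \<open>n\<close> and its derivative vanish there.\<close>
      show "(kdet e has_real_derivative (1 - e) / 2) (at 0 within {0..2*pi})"
        using dk[of 0] by (simp add: ecc_q1_def ecc_q2_def ecc_q1_deriv_def scal_q1_def scal_q2_def scal_q1_deriv_def field_simps)
    qed (use e in \<open>auto simp: n_def ends bc kdet_def scal_q2_def ecc_q2_def\<close>)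
    \<comment> \<open>At \<open>pi\<close> there is no singularity: \<open>kdet\<close> is positive,
      and \<open>n\<close> vanishes because \<open>ecc_q1_deriv\<close>, \<open>N2\<close> and
      \<open>q2\<close> do.\<close>
    have "(n \<longlongrightarrow> n pi) (at_left pi)" "(kdet e \<longlongrightarrow> kdet e pi) (at_left pi)"
      by (rule at_left_pi_tendsto[OF dn[OF _ dN1 dN2]] at_left_pi_tendsto[OF dk]; simp)+
    moreover have "kdet e pi \<noteq> 0" using kdet_pos[OF e, of pi] by simp
    ultimately have "(F \<longlongrightarrow> n pi / kdet e pi) (at_left pi)"
      unfolding F_def by (rule tendsto_divide)
    moreover have "n pi = 0" using bc[of pi] by (simp add: n_def ends)
    ultimately show "(F \<longlongrightarrow> 0) (at_left pi)" by simp
  next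
    fix u :: real assume "u \<in> {0, pi}"
    from bc[OF this] show "x u $ 3 * sol_v x u + x u $ 4 * sol_y x u = 0 \<and> x u $ 3 * x u $ 4 = 0"
      by (simp add: sol_v_def)
  qed
qed

section \<open>The monodromy matrix\<close>

text \<open>The coefficients are even about \<open>pi\<close>, so time reversal combined with a sign
  change of p1 and q2 preserves the system.\<close>

lemma solves_reflect:
  assumes x: "solves \<beta> e x"
  shows "solves \<beta> e (\<lambda>t. vector [- x (2*pi - t) $ 1, x (2*pi - t) $ 2, x (2*pi - t) $ 3, - x (2*pi - t) $ 4])"
proof -
  have img: "(\<lambda>t. 2*pi - t) ` {0..2*pi} = {0..2*pi}" by simp
  have ref: "((\<lambda>u. h (2*pi - u)) has_real_derivative - D) (at t within {0..2*pi})"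
    if "(h has_real_derivative D) (at (2*pi - t) within {0..2*pi})" for h D t
  proof -
    have "((\<lambda>u. 2*pi - u) has_real_derivative -1) (at t within {0..2*pi})"
      by (auto intro!: derivative_eq_intros)
    from DERIV_image_chain[OF _ this, of h D] that show ?thesis unfolding img by (simp add: o_def)
  qed
  have c: "coeff1 \<beta> e (2*pi - t) = coeff1 \<beta> e t" "coeff2 \<beta> e (2*pi - t) = coeff2 \<beta> e t" for t
    by (simp_all add: coeff1_def coeff2_def cos_diff)
  show ?thesis
  proof (rule solvesI)
    fix t assume "t \<in> {0..2*pi}"
    then have t: "2*pi - t \<in> {0..2*pi}" by auto
    note r = solves_component[OF x t, THEN ref, unfolded c]
    show "((\<lambda>t. - x (2*pi - t) $ 1) has_real_derivative x (2*pi - t) $ 2 - coeff1 \<beta> e t * x (2*pi - t) $ 3) (at t within {0..2*pi})"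
      using DERIV_minus[OF r(1)] by simp
    show "((\<lambda>t. x (2*pi - t) $ 2) has_real_derivative - (- x (2*pi - t) $ 1) - coeff2 \<beta> e t * (- x (2*pi - t) $ 4)) (at t within {0..2*pi})"
      using r(2) by (simp add: add.commute)
    show "((\<lambda>t. x (2*pi - t) $ 3) has_real_derivative - x (2*pi - t) $ 1 + - x (2*pi - t) $ 4) (at t within {0..2*pi})"
      using r(3) by simp
    show "((\<lambda>t. - x (2*pi - t) $ 4) has_real_derivative x (2*pi - t) $ 2 - x (2*pi - t) $ 3) (at t within {0..2*pi})"
      using DERIV_minus[OF r(4)] by simp
  qed
qed

definition monodromy :: "real \<Rightarrow> real \<Rightarrow> real^4^4" where
  "monodromy e \<beta> = fundamental_solution \<beta> e (2*pi)"

text \<open>A fixed vector gives a periodic solution. Its sum and difference with the reflected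
  solution fall into the two symmetry classes: the boundary conditions hold at \<open>pi\<close>
  because the reflection fixes that time, and at 0 by periodicity.\<close>

lemma monodromy_no_eigenvalue_1:
  assumes e: "0 \<le> e" "e < 1" and \<beta>: "0 < \<beta>" "\<beta> \<le> 9" and v: "monodromy e \<beta> *v v = v"
  shows "v = 0"
proof -
  let ?x = "\<lambda>t. fundamental_solution \<beta> e t *v v"
  let ?r = "\<lambda>t. vector [- ?x (2*pi - t) $ 1, ?x (2*pi - t) $ 2, ?x (2*pi - t) $ 3, - ?x (2*pi - t) $ 4] :: real^4"
  have x: "solves \<beta> e ?x" by (rule solves_fundamental[OF e])
  have per: "?x 0 = v" "?x (2*pi) = v" using v by (simp_all add: fundamental_solution_0[OF e] monodromy_def)
  have 0: "(0::real) \<in> {0..2*pi}" by simp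
  have "?x 0 + ?r 0 = 0"
    by (rule even_solution_zero[OF e \<beta> solves_add[OF x solves_reflect[OF x]] _ 0]) (auto simp: per)
  moreover have "?x 0 - ?r 0 = 0"
    by (rule odd_solution_zero[OF e \<beta> solves_diff[OF x solves_reflect[OF x]] _ 0]) (auto simp: per)
  ultimately show ?thesis by (simp add: per vec_eq_iff forall_4)
qed

text \<open>Its zeros are the \<open>\<beta>\<close> with an antiperiodic solution for which \<open>q1\<close> is even and \<open>q2\<close> is odd.\<close>

definition half_det :: "real \<Rightarrow> real \<Rightarrow> real" where
  "half_det e \<beta> = fundamental_solution \<beta> e pi $ 3 $ 3 * fundamental_solution \<beta> e pi $ 2 $ 2
     - fundamental_solution \<beta> e pi $ 3 $ 2 * fundamental_solution \<beta> e pi $ 2 $ 3"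

text \<open>A kernel vector of the 2 x 2 block gives a solution with \<open>p1 = q2 = 0\<close> at 0
  and \<open>p2 = q1 = 0\<close> at \<open>pi\<close>. At \<open>pi\<close> it equals minus its
  reflection, hence everywhere; comparison at \<open>2 * pi\<close> yields the eigenvalue.\<close>

lemma monodromy_eigenvalue_minus_1:
  assumes e: "0 \<le> e" "e < 1" and det: "half_det e \<beta> = 0"
  shows "\<exists>v. v \<noteq> 0 \<and> monodromy e \<beta> *v v = - v"
proof -
  let ?G = "fundamental_solution \<beta> e pi"
  have "\<exists>a b. (a, b) \<noteq> (0, 0) \<and> ?G$3$2 * a + ?G$3$3 * b = 0 \<and> ?G$2$2 * a + ?G$2$3 * b = 0"
  proof (cases "?G$3$3 = 0 \<and> ?G$3$2 = 0")
    case True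
    show ?thesis
    proof (cases "?G$2$2 = 0 \<and> ?G$2$3 = 0")
      case True
      then show ?thesis using \<open>?G$3$3 = 0 \<and> ?G$3$2 = 0\<close> by (intro exI[of _ 1] exI[of _ 0]) simp
    next
      case False
      then show ?thesis using True by (intro exI[of _ "?G$2$3"] exI[of _ "- ?G$2$2"]) auto
    qed
  next
    case False
    then show ?thesis using det
      by (intro exI[of _ "?G$3$3"] exI[of _ "- ?G$3$2"]) (auto simp: half_det_def algebra_simps)
  qed
  then obtain a b where ab: "(a, b) \<noteq> (0, 0)" "?G$3$2 * a + ?G$3$3 * b = 0" "?G$2$2 * a + ?G$2$3 * b = 0"
    by blast
  define v :: "real^4" where "v = vector [0, a, b, 0]"
  let ?x = "\<lambda>t. fundamental_solution \<beta> e t *v v"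
  let ?r = "\<lambda>t. vector [- ?x (2*pi - t) $ 1, ?x (2*pi - t) $ 2, ?x (2*pi - t) $ 3, - ?x (2*pi - t) $ 4] :: real^4"
  have x: "solves \<beta> e ?x" by (rule solves_fundamental[OF e])
  have x0: "?x 0 = v" by (simp add: fundamental_solution_0[OF e])
  have xpi: "?x pi $ 3 = 0" "?x pi $ 2 = 0"
    using ab by (simp_all add: v_def matrix_vector_mult_def sum_4)
  have "?x (2*pi) = 0 - ?r (2*pi)"
  proof (rule solves_unique[OF e x solves_diff[OF solves_zero solves_reflect[OF x]]])
    show "?x pi = 0 - ?r pi" using xpi by (simp add: vec_eq_iff forall_4)
  qed auto
  also have "\<dots> = - v" unfolding diff_self x0 by (simp add: v_def vec_eq_iff forall_4)
  finally have "monodromy e \<beta> *v v = - v" by (simp add: monodromy_def)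
  moreover have "v \<noteq> 0" using ab(1) by (auto simp: v_def vec_eq_iff forall_4)
  ultimately show ?thesis by blast
qed

text \<open>At \<open>\<beta> = 0\<close> one has \<open>coeff2 = 1\<close>, so
  \<open>p2 + q1\<close> is a constant \<open>c\<close>; the hypotheses are the system with both
  momenta eliminated.\<close>

lemma solves_kepler:
  assumes q: "\<And>t. t \<in> {0..2*pi} \<Longrightarrow> (q1 has_real_derivative qq1 t) (at t within {0..2*pi})"
      "\<And>t. t \<in> {0..2*pi} \<Longrightarrow> (q2 has_real_derivative c - 2 * q1 t) (at t within {0..2*pi})"
      "\<And>t. t \<in> {0..2*pi} \<Longrightarrow> (qq1 has_real_derivative kpot e t * q1 t + 2 * c) (at t within {0..2*pi})"
    and e: "0 \<le> e" "e < 1"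
  shows "solves 0 e (\<lambda>t. vector [qq1 t - q2 t, c - q1 t, q1 t, q2 t])"
proof (rule solvesI)
  fix t assume t: "t \<in> {0..2*pi}"
  have f: "1 + e * cos t \<noteq> 0" using ecc_pos[OF e, of t] by simp
  have s: "sqrt (9 - 0) = 3" using real_sqrt_abs[of 3] by simp
  have c1: "coeff1 0 e t = 1 - 3 / (1 + e * cos t)"
    using f unfolding coeff1_def s by (simp add: field_simps)
  have c2: "coeff2 0 e t = 1"
    using f unfolding coeff2_def s by (simp add: field_simps)
  show "((\<lambda>t. qq1 t - q2 t) has_real_derivative c - q1 t - coeff1 0 e t * q1 t) (at t within {0..2*pi})"
    using DERIV_diff[OF q(3)[OF t] q(2)[OF t]] by (simp add: c1 kpot_def algebra_simps)
  show "((\<lambda>t. c - q1 t) has_real_derivative - (qq1 t - q2 t) - coeff2 0 e t * q2 t) (at t within {0..2*pi})"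
    using DERIV_diff[OF DERIV_const q(1)[OF t]] by (simp add: c2)
  show "(q1 has_real_derivative qq1 t - q2 t + q2 t) (at t within {0..2*pi})" using q(1)[OF t] by simp
  show "(q2 has_real_derivative c - q1 t - q1 t) (at t within {0..2*pi})" using q(2)[OF t] by simp
qed

text \<open>Two explicit solutions determine the map of \<open>(p2, q1)\<close> from 0 to
  \<open>pi\<close>: \<open>(-1, 1 + e)\<close> goes to \<open>(1, e - 1)\<close> and
  \<open>(-1/2, 1)\<close> to itself, as \<open>ktime\<close> drops out of \<open>scal_q1\<close>
  where the sine vanishes. The determinant is therefore \<open>- (1 + e) / (1 - e)\<close>.\<close>

lemma half_det_0:
  assumes e: "0 \<le> e" "e < 1"
  shows "half_det e 0 < 0"
proof -
  let ?G = "fundamental_solution 0 e pi"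
  note kd = kepler_derivs[OF e]
  have pi: "pi \<in> {0..2*pi}" by simp
  have A: "solves 0 e (\<lambda>t. vector [ecc_q1_deriv e t - ecc_q2 e t, e - ecc_q1 e t, ecc_q1 e t, ecc_q2 e t])"
    by (rule solves_kepler[OF kd(1,2,3) e])
  have kd6: "(scal_q1_deriv e has_real_derivative kpot e t * scal_q1 e t + 2 * (1/2)) (at t within {0..2*pi})"
    if "t \<in> {0..2*pi}" for t using kd(6)[OF that] by simp
  have D: "solves 0 e (\<lambda>t. vector [scal_q1_deriv e t - scal_q2 e t, 1/2 - scal_q1 e t, scal_q1 e t, scal_q2 e t])"
    by (rule solves_kepler[OF kd(4,5) kd6 e])
  have "(vector [ecc_q1_deriv e pi - ecc_q2 e pi, e - ecc_q1 e pi, ecc_q1 e pi, ecc_q2 e pi] :: real^4)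
      = ?G *v vector [ecc_q1_deriv e 0 - ecc_q2 e 0, e - ecc_q1 e 0, ecc_q1 e 0, ecc_q2 e 0]"
    by (rule solves_eq_fundamental[OF e A pi])
  from arg_cong[OF this, of "\<lambda>v. v $ 2"] arg_cong[OF this, of "\<lambda>v. v $ 3"]
  have 1: "1 = - ?G$2$2 + ?G$2$3 * (1 + e)" "e - 1 = - ?G$3$2 + ?G$3$3 * (1 + e)"
    by (simp_all add: matrix_vector_mult_def sum_4 ecc_q1_def ecc_q2_def ecc_q1_deriv_def algebra_simps)
  have "(vector [scal_q1_deriv e pi - scal_q2 e pi, 1/2 - scal_q1 e pi, scal_q1 e pi, scal_q2 e pi] :: real^4)
      = ?G *v vector [scal_q1_deriv e 0 - scal_q2 e 0, 1/2 - scal_q1 e 0, scal_q1 e 0, scal_q2 e 0]"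
    by (rule solves_eq_fundamental[OF e D pi])
  note S = arg_cong[OF this, of "\<lambda>v. v $ 2"] arg_cong[OF this, of "\<lambda>v. v $ 3"]
  have 2: "- 1/2 = - ?G$2$2 / 2 + ?G$2$3"
    using S(1) by (simp add: matrix_vector_mult_def sum_4 scal_q1_def scal_q2_def scal_q1_deriv_def)
  have 3: "1 = - ?G$3$2 / 2 + ?G$3$3"
    using S(2) by (simp add: matrix_vector_mult_def sum_4 scal_q1_def scal_q2_def scal_q1_deriv_def)
  have "?G$2$2 = 2 * ?G$2$3 + 1" "?G$3$2 = 2 * ?G$3$3 - 2" using 2 3 by linarith+
  then have "half_det e 0 * (1 - e) = - (1 + e)"
    using 1 unfolding half_det_def by algebra
  then have "half_det e 0 * (1 - e) < 0" using e by simp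
  then show ?thesis using e by (simp add: mult_less_0_iff)
qed

section \<open>The Hill equation at \<open>\<beta> = 9\<close>\<close>

lemma cooperative_growth:
  fixes U V a b :: "real \<Rightarrow> real"
  assumes dU: "\<And>t. t \<in> {0..L} \<Longrightarrow> (U has_real_derivative a t * V t) (at t within {0..L})"
    and dV: "\<And>t. t \<in> {0..L} \<Longrightarrow> (V has_real_derivative b t * U t) (at t within {0..L})"
    and pos: "\<And>t. t \<in> {0..L} \<Longrightarrow> 0 < a t \<and> 0 < b t"
    and init: "0 < U 0" "V 0 = 0" and t: "0 < t" "t \<le> L"
  shows "U 0 < U t"
proof -
  \<comment> \<open>\<open>U V\<close> is nondecreasing from 0, hence nonnegative, and it drives the
    growth of \<open>U^2\<close>.\<close>
  have dUV: "((\<lambda>t. U t * V t) has_real_derivative a t * (V t)\<^sup>2 + b t * (U t)\<^sup>2) (at t within {0..L})"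
    if "t \<in> {0..L}" for t
    using DERIV_mult[OF dU[OF that] dV[OF that]] by (simp add: power2_eq_square algebra_simps)
  have dUU: "((\<lambda>t. (U t)\<^sup>2) has_real_derivative 2 * a t * (U t * V t)) (at t within {0..L})"
    if "t \<in> {0..L}" for t
    using DERIV_power[OF dU[OF that], of 2] by (simp add: algebra_simps)
  have UV: "0 \<le> U t * V t" if t: "t \<in> {0..L}" for t
  proof -
    have "U 0 * V 0 \<le> U t * V t"
    proof (rule DERIV_within_nonneg_imp_le[OF dUV])
      show "0 \<le> a u * (V u)\<^sup>2 + b u * (U u)\<^sup>2" if "u \<in> {0<..<t}" for u
        using pos[of u] that t by simp
    qed (use t in auto)
    then show ?thesis using init by simp
  qed
  have UU: "(U 0)\<^sup>2 \<le> (U t)\<^sup>2" if t: "t \<in> {0..L}" for t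
  proof (rule DERIV_within_nonneg_imp_le[OF dUU])
    show "0 \<le> 2 * a u * (U u * V u)" if "u \<in> {0<..<t}" for u
      using pos[of u] UV[of u] that t by (intro mult_nonneg_nonneg[of "2 * a u"]) auto
  qed (use t in auto)
  \<comment> \<open>The weak inequalities show that \<open>U\<close> never vanishes; this makes the
    derivative of \<open>U V\<close> strictly positive, and a second pass gives the strict
    inequalities.\<close>
  have U0: "U t \<noteq> 0" if t: "t \<in> {0..L}" for t using UU[OF t] init by auto
  have UV1: "0 < U t * V t" if t: "0 < t" "t \<le> L" for t
  proof -
    have "U 0 * V 0 < U t * V t"
    proof (rule DERIV_within_pos_imp_less[OF dUV])
      show "0 < a u * (V u)\<^sup>2 + b u * (U u)\<^sup>2" if "u \<in> {0<..<t}" for u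
        using pos[of u] U0[of u] that t by (intro add_nonneg_pos mult_nonneg_nonneg mult_pos_pos) auto
    qed (use t in auto)
    then show ?thesis using init by simp
  qed
  have lt: "(U 0)\<^sup>2 < (U t)\<^sup>2"
  proof (rule DERIV_within_pos_imp_less[OF dUU])
    show "0 < 2 * a u * (U u * V u)" if "u \<in> {0<..<t}" for u
      using pos[of u] UV1[of u] that t by (intro mult_pos_pos[of "2 * a u"]) auto
  qed (use t in auto)
  have "0 < U t"
  proof (rule ccontr)
    assume "\<not> 0 < U t"
    moreover have "continuous_on {0..t} U"
      by (rule continuous_on_subset[OF DERIV_continuous_on[OF dU]]) (use t in auto)
    ultimately obtain u where "0 \<le> u" "u \<le> t" "U u = 0"
      using IVT2'[of U t 0 0] init t by auto
    then show False using U0[of u] t by auto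
  qed
  then show ?thesis using lt power2_less_imp_less by fastforce
qed

text \<open>For \<open>w = 1 + e cos t\<close>, the functions \<open>U = \<phi> / w\<close> and
  \<open>W = \<eta> w - \<phi> w'\<close> satisfy \<open>U' = W / w^2\<close> and
  \<open>W' = (w / 2) U\<close>; the positive factor \<open>w / 2\<close> expresses that
  \<open>w\<close> is a strict supersolution. The two claims start from \<open>W = 0\<close> and
  from \<open>U = 0\<close>.\<close>

lemma hill_growth:
  fixes \<phi> \<eta> :: "real \<Rightarrow> real"
  assumes e: "0 \<le> e" "e < 1"
    and d\<phi>: "\<And>t. t \<in> {0..2*pi} \<Longrightarrow> (\<phi> has_real_derivative \<eta> t) (at t within {0..2*pi})"
    and d\<eta>: "\<And>t. t \<in> {0..2*pi} \<Longrightarrow> (\<eta> has_real_derivative - coeff1 9 e t * \<phi> t) (at t within {0..2*pi})"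
    and t: "0 < t" "t \<le> 2*pi"
  shows "\<phi> 0 = 1 \<Longrightarrow> \<eta> 0 = 0 \<Longrightarrow> \<phi> t / (1 + e * cos t) > 1 / (1 + e)"
    and "\<phi> 0 = 0 \<Longrightarrow> \<eta> 0 = 1 \<Longrightarrow> \<eta> t * (1 + e * cos t) + e * \<phi> t * sin t > 1 + e"
proof -
  have f: "0 < 1 + e * cos u" for u by (rule ecc_pos[OF e])
  define U where "U t = \<phi> t / (1 + e * cos t)" for t
  define W where "W t = \<eta> t * (1 + e * cos t) + e * \<phi> t * sin t" for t
  have dU: "(U has_real_derivative 1 / (1 + e * cos u)\<^sup>2 * W u) (at u within {0..2*pi})" if u: "u \<in> {0..2*pi}" for u
  proof -
    have "((\<lambda>u. 1 + e * cos u) has_real_derivative - e * sin u) (at u within {0..2*pi})"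
      by (auto intro!: derivative_eq_intros)
    note D = DERIV_divide[OF d\<phi>[OF u] this]
    show ?thesis unfolding U_def[abs_def] W_def
      by (rule DERIV_cong[OF D]) (use f[of u] in \<open>simp_all add: power2_eq_square algebra_simps\<close>)
  qed
  have dW: "(W has_real_derivative (1 + e * cos u) / 2 * U u) (at u within {0..2*pi})" if u: "u \<in> {0..2*pi}" for u
  proof -
    have 1: "((\<lambda>u. 1 + e * cos u) has_real_derivative - e * sin u) (at u within {0..2*pi})"
      and 2: "(sin has_real_derivative cos u) (at u within {0..2*pi})"
      by (auto intro!: derivative_eq_intros)
    note D = DERIV_add[OF DERIV_mult[OF d\<eta>[OF u] 1] DERIV_mult[OF DERIV_cmult[OF d\<phi>[OF u], of e] 2]]
    have b: "coeff1 9 e u * (1 + e * cos u) = e * cos u - 1/2"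
      using f[of u] by (simp add: coeff1_def field_simps)
    have "- coeff1 9 e u * \<phi> u * (1 + e * cos u) = (1/2 - e * cos u) * \<phi> u"
      using b by algebra
    moreover have "(1 + e * cos u) * U u = \<phi> u" using f[of u] by (simp add: U_def)
    then have "(1 + e * cos u) / 2 * U u = \<phi> u / 2" by simp
    ultimately show ?thesis unfolding W_def[abs_def]
      by (intro DERIV_cong[OF D]) (simp add: algebra_simps)
  qed
  have pos: "0 < 1 / (1 + e * cos u)\<^sup>2 \<and> 0 < (1 + e * cos u) / 2" for u using f[of u] by simp
  show "\<phi> t / (1 + e * cos t) > 1 / (1 + e)" if "\<phi> 0 = 1" "\<eta> 0 = 0"
    using cooperative_growth[OF dU dW pos _ _ t] that e by (simp add: U_def W_def)
  show "\<eta> t * (1 + e * cos t) + e * \<phi> t * sin t > 1 + e" if "\<phi> 0 = 0" "\<eta> 0 = 1"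
    using cooperative_growth[OF dW dU _ _ _ t] pos that e by (simp add: U_def W_def)
qed

text \<open>At \<open>\<beta> = 9\<close> the two coefficients agree, so rotating back by the angle
  \<open>t\<close> uncouples the axes, and the rotated momentum is the velocity.\<close>

lemma solves_rotated:
  assumes x: "solves 9 e x" and t: "t \<in> {0..2*pi}"
  shows "((\<lambda>t. x t $ 3 * cos t - x t $ 4 * sin t) has_real_derivative x t $ 1 * cos t - x t $ 2 * sin t) (at t within {0..2*pi})"
    "((\<lambda>t. x t $ 1 * cos t - x t $ 2 * sin t) has_real_derivative - coeff1 9 e t * (x t $ 3 * cos t - x t $ 4 * sin t)) (at t within {0..2*pi})"
proof -
  note c = solves_component[OF x t]
  have s: "(sin has_real_derivative cos t) (at t within {0..2*pi})" "(cos has_real_derivative - sin t) (at t within {0..2*pi})"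
    by (auto intro!: derivative_eq_intros)
  have c2: "coeff2 9 e t = coeff1 9 e t" by (simp add: coeff1_def coeff2_def)
  show "((\<lambda>t. x t $ 3 * cos t - x t $ 4 * sin t) has_real_derivative x t $ 1 * cos t - x t $ 2 * sin t) (at t within {0..2*pi})"
    by (rule DERIV_cong[OF DERIV_diff[OF DERIV_mult[OF c(3) s(2)] DERIV_mult[OF c(4) s(1)]]])
      (simp add: algebra_simps)
  show "((\<lambda>t. x t $ 1 * cos t - x t $ 2 * sin t) has_real_derivative - coeff1 9 e t * (x t $ 3 * cos t - x t $ 4 * sin t)) (at t within {0..2*pi})"
    by (rule DERIV_cong[OF DERIV_diff[OF DERIV_mult[OF c(1) s(2)] DERIV_mult[OF c(2) s(1)]]])
      (simp add: algebra_simps c2)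
qed

lemma solves_from_hill:
  assumes d\<phi>: "\<And>t. t \<in> {0..2*pi} \<Longrightarrow> (\<phi> has_real_derivative \<eta> t) (at t within {0..2*pi})"
    and d\<eta>: "\<And>t. t \<in> {0..2*pi} \<Longrightarrow> (\<eta> has_real_derivative - coeff1 9 e t * \<phi> t) (at t within {0..2*pi})"
  shows "solves 9 e (\<lambda>t. vector [\<eta> t * cos t, - \<eta> t * sin t, \<phi> t * cos t, - \<phi> t * sin t])"
    and "solves 9 e (\<lambda>t. vector [\<eta> t * sin t, \<eta> t * cos t, \<phi> t * sin t, \<phi> t * cos t])"
proof -
  have c2: "coeff2 9 e t = coeff1 9 e t" for t by (simp add: coeff1_def coeff2_def)
  have s: "(sin has_real_derivative cos t) (at t within {0..2*pi})" "(cos has_real_derivative - sin t) (at t within {0..2*pi})" for t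
    by (auto intro!: derivative_eq_intros)
  show "solves 9 e (\<lambda>t. vector [\<eta> t * cos t, - \<eta> t * sin t, \<phi> t * cos t, - \<phi> t * sin t])"
    by (rule solvesI; rule DERIV_cong,
        (rule DERIV_mult DERIV_minus s d\<phi> d\<eta> | assumption)+, simp add: c2 algebra_simps)
  show "solves 9 e (\<lambda>t. vector [\<eta> t * sin t, \<eta> t * cos t, \<phi> t * sin t, \<phi> t * cos t])"
    by (rule solvesI; rule DERIV_cong,
        (rule DERIV_mult DERIV_minus s d\<phi> d\<eta> | assumption)+, simp add: c2 algebra_simps)
qed

lemma matrix_axis_component: "(A *v axis j 1) $ i = (A :: real^'n^'m) $ i $ j"
  by (simp add: matrix_vector_mult_basis column_def)

lemma axis4_component [simp]:
  "(axis 1 1 :: real^4) = vector [1, 0, 0, 0]" "(axis 2 1 :: real^4) = vector [0, 1, 0, 0]"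
  "(axis 3 1 :: real^4) = vector [0, 0, 1, 0]" "(axis 4 1 :: real^4) = vector [0, 0, 0, 1]"
  by (simp_all add: vec_eq_iff forall_4 axis_def)

text \<open>\<open>\<phi>\<close> and \<open>\<psi>\<close> are the Hill solutions with initial data
  \<open>(1, 0)\<close> and \<open>(0, 1)\<close>, with derivatives \<open>\<eta>\<close> and
  \<open>\<omega>\<close>; each column is one of them placed on one axis and rotated.\<close>

lemma fundamental_solution_9:
  assumes e: "0 \<le> e" "e < 1"
  obtains \<phi> \<eta> \<psi> \<omega> :: "real \<Rightarrow> real" where
    "\<And>t. 0 < t \<Longrightarrow> t \<le> 2*pi \<Longrightarrow> \<phi> t / (1 + e * cos t) > 1 / (1 + e)"
    "\<And>t. 0 < t \<Longrightarrow> t \<le> 2*pi \<Longrightarrow> \<omega> t * (1 + e * cos t) + e * \<psi> t * sin t > 1 + e"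
    "\<And>t. t \<in> {0..2*pi} \<Longrightarrow> fundamental_solution 9 e t *v axis 1 1 = vector [\<omega> t * cos t, - \<omega> t * sin t, \<psi> t * cos t, - \<psi> t * sin t]"
    "\<And>t. t \<in> {0..2*pi} \<Longrightarrow> fundamental_solution 9 e t *v axis 2 1 = vector [\<omega> t * sin t, \<omega> t * cos t, \<psi> t * sin t, \<psi> t * cos t]"
    "\<And>t. t \<in> {0..2*pi} \<Longrightarrow> fundamental_solution 9 e t *v axis 3 1 = vector [\<eta> t * cos t, - \<eta> t * sin t, \<phi> t * cos t, - \<phi> t * sin t]"
    "\<And>t. t \<in> {0..2*pi} \<Longrightarrow> fundamental_solution 9 e t *v axis 4 1 = vector [\<eta> t * sin t, \<eta> t * cos t, \<phi> t * sin t, \<phi> t * cos t]"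
proof -
  define x where "x v t = fundamental_solution 9 e t *v v" for v t
  have x: "solves 9 e (x v)" for v unfolding x_def[abs_def] by (rule solves_fundamental[OF e])
  have x0: "x v 0 = v" for v by (simp add: x_def fundamental_solution_0[OF e])
  define p where "p v t = x v t $ 3 * cos t - x v t $ 4 * sin t" for v t
  define q where "q v t = x v t $ 1 * cos t - x v t $ 2 * sin t" for v t
  have dp: "(p v has_real_derivative q v t) (at t within {0..2*pi})"
    and dq: "(q v has_real_derivative - coeff1 9 e t * p v t) (at t within {0..2*pi})"
    if "t \<in> {0..2*pi}" for v t
    using solves_rotated[OF x that, of v] by (simp_all add: p_def[abs_def] q_def[abs_def])
  have eq: "x (vector [q v 0, 0, p v 0, 0]) t = vector [q v t * cos t, - q v t * sin t, p v t * cos t, - p v t * sin t]"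
    "x (vector [0, q v 0, 0, p v 0]) t = vector [q v t * sin t, q v t * cos t, p v t * sin t, p v t * cos t]"
    if t: "t \<in> {0..2*pi}" for v t
    using solves_eq_fundamental[OF e solves_from_hill(1)[OF dp dq, of v] t]
      solves_eq_fundamental[OF e solves_from_hill(2)[OF dp dq, of v] t] by (simp_all add: x_def)
  have i: "p (axis 1 1) 0 = 0" "q (axis 1 1) 0 = 1" "p (axis 3 1) 0 = 1" "q (axis 3 1) 0 = 0"
    by (simp_all add: p_def q_def x0)
  show ?thesis
  proof (rule that[where \<phi> = "p (axis 3 1)" and \<eta> = "q (axis 3 1)" and \<psi> = "p (axis 1 1)" and \<omega> = "q (axis 1 1)"])
    show "p (axis 3 1) t / (1 + e * cos t) > 1 / (1 + e)" if "0 < t" "t \<le> 2*pi" for t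
      by (rule hill_growth(1)[OF e dp dq that i(3,4)])
    show "q (axis 1 1) t * (1 + e * cos t) + e * p (axis 1 1) t * sin t > 1 + e" if "0 < t" "t \<le> 2*pi" for t
      by (rule hill_growth(2)[OF e dp dq that i(1,2)])
  qed (use eq[where v = "axis 1 1"] eq[where v = "axis 3 1"] in \<open>simp_all add: i x_def del: axis4_component add: axis4_component[symmetric]\<close>)
qed

text \<open>At \<open>pi\<close> the rotation is minus the identity, and \<open>half_det\<close>
  becomes \<open>\<phi> \<omega>\<close>. At \<open>2 * pi\<close> it is the identity, and the
  monodromy consists of two copies of the Hill monodromy: its trace is
  \<open>2 (\<phi> + \<omega>)\<close> and the quadratic is a perfect square.\<close>

lemma beta_9:
  assumes e: "0 \<le> e" "e < 1"
  shows half_det_9: "0 < half_det e 9"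
    and lin_coeff_9: "4 < lin_coeff (monodromy e 9)"
    and disc4_9: "disc4 (monodromy e 9) = 0"
proof -
  obtain \<phi> \<eta> \<psi> \<omega> where
    g: "\<And>t. 0 < t \<Longrightarrow> t \<le> 2*pi \<Longrightarrow> \<phi> t / (1 + e * cos t) > 1 / (1 + e)"
    "\<And>t. 0 < t \<Longrightarrow> t \<le> 2*pi \<Longrightarrow> \<omega> t * (1 + e * cos t) + e * \<psi> t * sin t > 1 + e"
   and c: "\<And>t. t \<in> {0..2*pi} \<Longrightarrow> fundamental_solution 9 e t *v axis 1 1 = vector [\<omega> t * cos t, - \<omega> t * sin t, \<psi> t * cos t, - \<psi> t * sin t]"
    "\<And>t. t \<in> {0..2*pi} \<Longrightarrow> fundamental_solution 9 e t *v axis 2 1 = vector [\<omega> t * sin t, \<omega> t * cos t, \<psi> t * sin t, \<psi> t * cos t]"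
    "\<And>t. t \<in> {0..2*pi} \<Longrightarrow> fundamental_solution 9 e t *v axis 3 1 = vector [\<eta> t * cos t, - \<eta> t * sin t, \<phi> t * cos t, - \<phi> t * sin t]"
    "\<And>t. t \<in> {0..2*pi} \<Longrightarrow> fundamental_solution 9 e t *v axis 4 1 = vector [\<eta> t * sin t, \<eta> t * cos t, \<phi> t * sin t, \<phi> t * cos t]"
    by (rule fundamental_solution_9[OF e]) (rule that; assumption)
  have m: "fundamental_solution 9 e t $ i $ 1 = vector [\<omega> t * cos t, - \<omega> t * sin t, \<psi> t * cos t, - \<psi> t * sin t] $ i"
    "fundamental_solution 9 e t $ i $ 2 = vector [\<omega> t * sin t, \<omega> t * cos t, \<psi> t * sin t, \<psi> t * cos t] $ i"
    "fundamental_solution 9 e t $ i $ 3 = vector [\<eta> t * cos t, - \<eta> t * sin t, \<phi> t * cos t, - \<phi> t * sin t] $ i"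
    "fundamental_solution 9 e t $ i $ 4 = vector [\<eta> t * sin t, \<eta> t * cos t, \<phi> t * sin t, \<phi> t * cos t] $ i"
    if "t \<in> {0..2*pi}" for t i
    unfolding matrix_axis_component[symmetric] c[OF that] by simp_all
  have "0 < 1 / (1 + e)" using e by simp
  also have "\<dots> < \<phi> pi / (1 - e)" using g(1)[of pi] by simp
  finally have "0 < \<phi> pi / (1 - e)" .
  then have "0 < \<phi> pi" using e by (simp add: zero_less_divide_iff)
  moreover have "1 + e < \<omega> pi * (1 - e)" using g(2)[of pi] by simp
  then have "0 < \<omega> pi * (1 - e)" using e by linarith
  then have "0 < \<omega> pi" using e by (simp add: zero_less_mult_iff)
  ultimately show "0 < half_det e 9" by (simp add: half_det_def m)
  have "1 / (1 + e) < \<phi> (2*pi) / (1 + e)" using g(1)[of "2*pi"] by simp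
  then have "1 < \<phi> (2*pi)" using e by (simp add: divide_less_cancel)
  moreover have "1 * (1 + e) < \<omega> (2*pi) * (1 + e)" using g(2)[of "2*pi"] by simp
  then have "1 < \<omega> (2*pi)" using e by (subst (asm) mult_less_cancel_right_pos) auto
  ultimately show "4 < lin_coeff (monodromy e 9)" by (simp add: lin_coeff_def monodromy_def m)
  show "disc4 (monodromy e 9) = 0"
    by (simp add: disc4_def lin_coeff_def const_coeff_def monodromy_def m power2_eq_square algebra_simps)
qed

section \<open>Continuity in \<open>\<beta>\<close> and the conclusion\<close>

lemma monodromy_symplectic: "0 \<le> e \<Longrightarrow> e < 1 \<Longrightarrow> symplectic4 (monodromy e \<beta>)"
  unfolding monodromy_def by (rule fundamental_solution_symplectic) auto

lemma continuous_on_monodromy: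
  assumes e: "0 \<le> e" "e < 1"
  shows "continuous_on {0..9} (\<lambda>\<beta>. lin_coeff (monodromy e \<beta>))"
    "continuous_on {0..9} (\<lambda>\<beta>. const_coeff (monodromy e \<beta>))"
    "continuous_on {0..9} (half_det e)"
proof -
  have c: "continuous_on {0..9} (\<lambda>\<beta>. monodromy e \<beta>)" "continuous_on {0..9} (\<lambda>\<beta>. fundamental_solution \<beta> e pi)"
    unfolding monodromy_def by (rule continuous_on_fundamental_solution[OF e]; simp)+
  show "continuous_on {0..9} (\<lambda>\<beta>. lin_coeff (monodromy e \<beta>))"
    "continuous_on {0..9} (\<lambda>\<beta>. const_coeff (monodromy e \<beta>))"
    "continuous_on {0..9} (half_det e)"
    unfolding lin_coeff_def const_coeff_def half_det_def[abs_def] by (intro continuous_intros c)+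
qed

text \<open>The endpoint 9 drops out because the discriminant vanishes there; on the resulting open
  interval, openness is a matter of continuity.\<close>

lemma complex_saddle_set_eq:
  assumes e: "0 \<le> e" "e < 1"
  shows "complex_saddle_set e = {\<beta> \<in> {0<..<9}. disc4 (monodromy e \<beta>) < 0}"
proof -
  have "complex_saddle_set e = {\<beta> \<in> {0<..9}. disc4 (monodromy e \<beta>) < 0}"
    unfolding complex_saddle_set_def monodromy_def[symmetric]
      complex_saddle_iff[OF monodromy_symplectic[OF e]] ..
  moreover have "\<beta> \<noteq> 9" if "disc4 (monodromy e \<beta>) < 0" for \<beta> using that disc4_9[OF e] by auto
  ultimately show ?thesis by (auto simp: less_le)
qed

lemma ex_complex_saddle:
  assumes e: "0 \<le> e" "e < 1"
  shows "\<exists>\<beta>\<in>{0<..<9}. disc4 (monodromy e \<beta>) < 0"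
proof -
  let ?M = "monodromy e"
  let ?c = "\<lambda>\<beta>. 4 - 2 * lin_coeff (?M \<beta>) + const_coeff (?M \<beta>)"
  note cont = continuous_on_monodromy[OF e]
  have c9: "0 < ?c 9"
  proof -
    \<comment> \<open>With discriminant zero the quadratic is the square of
      \<open>u - lin_coeff / 2\<close>, here taken at \<open>u = 2\<close>.\<close>
    have "?c 9 = (2 - lin_coeff (?M 9) / 2)\<^sup>2"
      using disc4_9[OF e] by (simp add: disc4_def power2_eq_square field_simps)
    moreover have "2 - lin_coeff (?M 9) / 2 \<noteq> 0" using lin_coeff_9[OF e] by simp
    ultimately show ?thesis by simp
  qed
  \<comment> \<open>Going down from 9, a change of sign would produce a root at 2, hence the
    eigenvalue 1.\<close>
  have cpos: "0 < ?c \<beta>" if \<beta>: "0 < \<beta>" "\<beta> < 9" for \<beta>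
  proof (rule ccontr)
    assume "\<not> 0 < ?c \<beta>"
    moreover have "continuous_on {\<beta>..9} ?c"
      by (intro continuous_intros continuous_on_subset[OF cont(1)] continuous_on_subset[OF cont(2)])
        (use \<beta> in auto)
    ultimately obtain b where b: "\<beta> \<le> b" "b \<le> 9" "?c b = 0"
      using IVT'[of ?c \<beta> 0 9] c9 \<beta> by auto
    then show False
      using quadratic_at_2_nonzero[OF monodromy_symplectic[OF e] monodromy_no_eigenvalue_1[OF e, of b]] \<beta> by auto
  qed
  obtain b1 where b1: "0 \<le> b1" "b1 \<le> 9" "half_det e b1 = 0"
    using IVT'[of "half_det e" 0 0 9] half_det_0[OF e] half_det_9[OF e] cont(3) by auto
  have b1': "0 < b1" "b1 < 9" using b1 half_det_0[OF e] half_det_9[OF e] by (auto simp: less_le)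
  obtain v where "v \<noteq> 0" "?M b1 *v v = - v" using monodromy_eigenvalue_minus_1[OF e b1(3)] by blast
  then have "4 + 2 * lin_coeff (?M b1) + const_coeff (?M b1) = 0"
    by (rule quadratic_at_minus_2[OF monodromy_symplectic[OF e]])
  \<comment> \<open>The values of the quadratic at 2 and -2 differ by
    \<open>- 4 * lin_coeff\<close>, so \<open>lin_coeff\<close> is even negative here.\<close>
  then have lin: "lin_coeff (?M b1) < 4" using cpos[OF b1'] by linarith
  have "continuous_on {b1..9} (\<lambda>\<beta>. lin_coeff (?M \<beta>))"
    by (rule continuous_on_subset[OF cont(1)]) (use b1 in auto)
  then obtain b2 where b2: "b1 \<le> b2" "b2 \<le> 9" "lin_coeff (?M b2) = 4"
    using IVT'[of "\<lambda>\<beta>. lin_coeff (?M \<beta>)" b1 4 9] lin lin_coeff_9[OF e] b1 by auto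
  have b2': "b2 < 9" using b2 lin_coeff_9[OF e] by (auto simp: less_le)
  have "disc4 (?M b2) < 0" using cpos[of b2] b1' b2 b2' by (simp add: disc4_def)
  then show ?thesis using b1' b2 b2' by (intro bexI[of _ b2]) auto
qed

theorem theorem1p9:
  fixes e :: real
  assumes "0 \<le> e" and "e < 1"
  shows "complex_saddle_set e \<noteq> {} \<and> open (complex_saddle_set e)"
proof
  show "complex_saddle_set e \<noteq> {}"
    using ex_complex_saddle[OF assms] by (auto simp: complex_saddle_set_eq[OF assms])
  have "continuous_on {0<..<9} (\<lambda>\<beta>. disc4 (monodromy e \<beta>))"
    unfolding disc4_def
    by (intro continuous_intros continuous_on_subset[OF continuous_on_monodromy(1)[OF assms]]
        continuous_on_subset[OF continuous_on_monodromy(2)[OF assms]]) auto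
  then have "open ({0<..<9} \<inter> (\<lambda>\<beta>. disc4 (monodromy e \<beta>)) -` {..<0})"
    by (rule continuous_open_preimage) auto
  then show "open (complex_saddle_set e)"
    by (simp add: complex_saddle_set_eq[OF assms] Int_def vimage_def)
qed

end
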